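(* Let $X$ be an $F$-space which is not isomorphic to $\ell_2$. Suppose that $X$ has a symmetric basis. Then the isometry group $\operatorname{Iso}(X)$ is algebraically reflexive.
   Context: Spaces are over $\mathbb K=\mathbb R$ or $\mathbb C$. An $F$-norm on a vector space $X$ is a function $\|\cdot\|:X\to[0,\infty)$ such that: $\|x\|>0$ for $x\ne0$; $\|\alpha x\|\le\|x\|$ for all $x$ and all scalars $|\alpha|\le1$; $\lim_{\alpha\to0}\|\alpha x\|=0$ for all $x$; and $\|x+y\|\le\|x\|+\|y\|$ for all $x,y$. It induces the translation-invariant metric $\|x-y\|$ and a linear topology. An $F$-space is a complete $F$-normed space. "Isomorphic" means linearly homeomorphic. A basis of $X$ is a sequence $(e_n)_{n\in\mathbb N}$ such that every $x\in X$ has a unique expansion $x=\sum_{n=1}^\infty x_ne_n$ with scalars $x_n$. It is symmetric if $\left\|\sum_{n=1}^\infty x_ne_n\right\|=\left\|\sum_{n=1}^\infty\varepsilon_nx_ne_{\pi(n)}\right\|$ for every $x=\sum x_ne_n \in X$, every choice of scalars $\varepsilon_n$ of modulus 1 and every permutation $\pi$ of the positive integers. $\operatorname{Iso}(X)$ is the group of all surjective linear isometries of $X$ (linear $T$ with $\|Tx\|=\|x\|$ for all $x$). $B(X)$ is the algebra of all continuous linear operators on $X$. For $\mathscr S\subset B(X)$ put $\operatorname{ref}_{al}\mathscr S=\{T\in B(X): \text{for every }x\in X\text{ there is }L\in\mathscr S\text{ with }Tx=Lx\}$; $\mathscr S$ is algebraically reflexive if $\operatorname{ref}_{al}\mathscr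 S=\mathscr S$. *)

theory Defs
  imports "HOL-Analysis.Analysis" "HOL-Library.Function_Algebras"
begin

(* The space X is the whole type 'a, with a scalar multiplication given as a parameter
   because the library has no type class of vector spaces over the complex numbers.
   Definitions are made over any real normed field; they are meant for real and complex. *)

locale F_normed_space = vector_space smul
  for smul :: "'k::real_normed_field \<Rightarrow> 'a::ab_group_add \<Rightarrow> 'a" +
  fixes fnorm :: "'a \<Rightarrow> real"
  assumes fnorm_nonneg: "0 \<le> fnorm x"
    and fnorm_pos: "x \<noteq> 0 \<Longrightarrow> 0 < fnorm x"
    and fnorm_smul_le: "norm a \<le> 1 \<Longrightarrow> fnorm (smul a x) \<le> fnorm x"
    and fnorm_smul_tendsto: "((\<lambda>a. fnorm (smul a x)) \<longlongrightarrow> 0) (at 0)"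
    and fnorm_triangle: "fnorm (x + y) \<le> fnorm x + fnorm y"

definition fdist :: "('a::ab_group_add \<Rightarrow> real) \<Rightarrow> 'a \<Rightarrow> 'a \<Rightarrow> real"
  where "fdist fnorm x y = fnorm (x - y)"

definition ftopology :: "('a::ab_group_add \<Rightarrow> real) \<Rightarrow> 'a topology"
  where "ftopology fnorm = Metric_space.mtopology UNIV (fdist fnorm)"

locale F_space = F_normed_space +
  assumes complete: "Metric_space.mcomplete UNIV (fdist fnorm)"

lemma (in F_normed_space) Metric_space_fdist: "Metric_space UNIV (fdist fnorm)"
proof -
  have f0: "fnorm 0 = 0"
  proof -
    have "((\<lambda>a::'k. fnorm 0) \<longlongrightarrow> 0) (at 0)"
      using fnorm_smul_tendsto[of 0] by simp
    then show ?thesis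
      by (simp add: tendsto_const_iff)
  qed
  have neg: "fnorm (- x) = fnorm x" for x
    using fnorm_smul_le[of "-1" x] fnorm_smul_le[of "-1" "- x"] by simp
  show ?thesis
  proof
    fix x y z
    show "0 \<le> fdist fnorm x y"
      by (simp add: fdist_def fnorm_nonneg)
    show "fdist fnorm x y = fdist fnorm y x"
      using neg[of "x - y"] by (simp add: fdist_def)
    show "(fdist fnorm x y = 0) = (x = y)"
      using fnorm_pos[of "x - y"] f0 by (cases "x = y") (auto simp: fdist_def)
    show "fdist fnorm x z \<le> fdist fnorm x y + fdist fnorm y z"
      using fnorm_triangle[of "x - y" "y - z"] by (simp add: fdist_def)
  qed
qed

(* The series of the c n * e n converges to x in the topology of the F-norm. *)
definition expansion ::
  "('k::real_normed_field \<Rightarrow> 'a::ab_group_add \<Rightarrow> 'a) \<Rightarrow> ('a \<Rightarrow> real) \<Rightarrow> (nat \<Rightarrow> 'a) \<Rightarrow> (nat \<Rightarrow> 'k) \<Rightarrow> 'a \<Rightarrow> bool"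
  where "expansion smul fnorm e c x \<longleftrightarrow>
    limitin (ftopology fnorm) (\<lambda>n. \<Sum>k<n. smul (c k) (e k)) x sequentially"

definition basis ::
  "('k::real_normed_field \<Rightarrow> 'a::ab_group_add \<Rightarrow> 'a) \<Rightarrow> ('a \<Rightarrow> real) \<Rightarrow> (nat \<Rightarrow> 'a) \<Rightarrow> bool"
  where "basis smul fnorm e \<longleftrightarrow> (\<forall>x. \<exists>!c. expansion smul fnorm e c x)"

(* Convergence of the rearranged series is part of the symmetry condition. *)
definition symmetric_basis ::
  "('k::real_normed_field \<Rightarrow> 'a::ab_group_add \<Rightarrow> 'a) \<Rightarrow> ('a \<Rightarrow> real) \<Rightarrow> (nat \<Rightarrow> 'a) \<Rightarrow> bool"
  where "symmetric_basis smul fnorm e \<longleftrightarrow> basis smul fnorm e \<and>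
    (\<forall>x c \<epsilon> \<pi>. expansion smul fnorm e c x \<and> (\<forall>n. norm (\<epsilon> n) = 1) \<and> bij \<pi> \<longrightarrow>
      (\<exists>y. expansion smul fnorm (\<lambda>n. e (\<pi> n)) (\<lambda>n. \<epsilon> n * c n) y \<and> fnorm x = fnorm y))"

definition Iso ::
  "('k::real_normed_field \<Rightarrow> 'a::ab_group_add \<Rightarrow> 'a) \<Rightarrow> ('a \<Rightarrow> real) \<Rightarrow> ('a \<Rightarrow> 'a) set"
  where "Iso smul fnorm =
    {T. Vector_Spaces.linear smul smul T \<and> surj T \<and> (\<forall>x. fnorm (T x) = fnorm x)}"

definition continuous_operators ::
  "('k::real_normed_field \<Rightarrow> 'a::ab_group_add \<Rightarrow> 'a) \<Rightarrow> ('a \<Rightarrow> real) \<Rightarrow> ('a \<Rightarrow> 'a) set"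
  where "continuous_operators smul fnorm =
    {T. Vector_Spaces.linear smul smul T \<and> continuous_map (ftopology fnorm) (ftopology fnorm) T}"

definition ref_al ::
  "('k::real_normed_field \<Rightarrow> 'a::ab_group_add \<Rightarrow> 'a) \<Rightarrow> ('a \<Rightarrow> real) \<Rightarrow> ('a \<Rightarrow> 'a) set \<Rightarrow> ('a \<Rightarrow> 'a) set"
  where "ref_al smul fnorm S =
    {T \<in> continuous_operators smul fnorm. \<forall>x. \<exists>L\<in>S. T x = L x}"

definition algebraically_reflexive ::
  "('k::real_normed_field \<Rightarrow> 'a::ab_group_add \<Rightarrow> 'a) \<Rightarrow> ('a \<Rightarrow> real) \<Rightarrow> ('a \<Rightarrow> 'a) set \<Rightarrow> bool"
  where "algebraically_reflexive smul fnorm S \<longleftrightarrow> ref_al smul fnorm S = S"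

definition ell2 :: "(nat \<Rightarrow> 'k::real_normed_field) set"
  where "ell2 = {f. summable (\<lambda>n. (norm (f n))\<^sup>2)}"

(* The value 0 outside ell2 makes the distance nonnegative on all pairs of sequences, as
   the locale Metric_space requires; the sum of a divergent series is unspecified. *)
definition ell2_norm :: "(nat \<Rightarrow> 'k::real_normed_field) \<Rightarrow> real"
  where "ell2_norm f = (if f \<in> ell2 then sqrt (\<Sum>n. (norm (f n))\<^sup>2) else 0)"

definition ell2_topology :: "(nat \<Rightarrow> 'k::real_normed_field) topology"
  where "ell2_topology = Metric_space.mtopology ell2 (\<lambda>f g. ell2_norm (f - g))"

definition seq_smul :: "'k::real_normed_field \<Rightarrow> (nat \<Rightarrow> 'k) \<Rightarrow> nat \<Rightarrow> 'k"
  where "seq_smul a f = (\<lambda>n. a * f n)"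

(* The map is linear into the space of all sequences; since the topspace of ell2_topology is
   ell2, being a homeomorphic map forces its range to be exactly ell2. *)
definition isomorphic_to_ell2 ::
  "('k::real_normed_field \<Rightarrow> 'a::ab_group_add \<Rightarrow> 'a) \<Rightarrow> ('a \<Rightarrow> real) \<Rightarrow> bool"
  where "isomorphic_to_ell2 smul fnorm \<longleftrightarrow>
    (\<exists>T. Vector_Spaces.linear smul seq_smul T \<and>
         homeomorphic_map (ftopology fnorm) ell2_topology T)"

lemma vector_space_seq_smul: "vector_space (seq_smul :: 'k::real_normed_field \<Rightarrow> _)"
  by unfold_locales (auto simp: seq_smul_def fun_eq_iff algebra_simps)

lemma ell2_add:
  fixes f g :: "nat \<Rightarrow> 'k::real_normed_field"
  assumes "f \<in> ell2" "g \<in> ell2"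
  shows "f + g \<in> ell2" "ell2_norm (f + g) \<le> ell2_norm f + ell2_norm g"
proof -
  have sf: "summable (\<lambda>n. (norm (f n))\<^sup>2)" and sg: "summable (\<lambda>n. (norm (g n))\<^sup>2)"
    using assms by (auto simp: ell2_def)
  have nn: "0 \<le> ell2_norm f + ell2_norm g"
    by (simp add: ell2_norm_def ell2_def suminf_nonneg)
  have part: "L2_set (\<lambda>i. norm (h i)) {..<n} \<le> ell2_norm h"
    if "summable (\<lambda>n. (norm (h n))\<^sup>2)" for h :: "nat \<Rightarrow> 'k" and n
    unfolding L2_set_def ell2_norm_def ell2_def using that by (auto intro!: sum_le_suminf)
  have bound: "(\<Sum>i<n. (norm ((f + g) i))\<^sup>2) \<le> (ell2_norm f + ell2_norm g)\<^sup>2" for n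
  proof -
    have "L2_set (\<lambda>i. norm ((f + g) i)) {..<n} \<le> L2_set (\<lambda>i. norm (f i) + norm (g i)) {..<n}"
      by (intro L2_set_mono) (auto simp: norm_triangle_ineq)
    also have "\<dots> \<le> L2_set (\<lambda>i. norm (f i)) {..<n} + L2_set (\<lambda>i. norm (g i)) {..<n}"
      by (rule L2_set_triangle_ineq)
    also have "\<dots> \<le> ell2_norm f + ell2_norm g"
      by (intro add_mono part sf sg)
    finally show ?thesis
      unfolding L2_set_def by (rule sqrt_le_D)
  qed
  show s: "f + g \<in> ell2"
    unfolding ell2_def using bound by (auto intro!: summableI_nonneg_bounded)
  have "(\<Sum>n. (norm ((f + g) n))\<^sup>2) \<le> (ell2_norm f + ell2_norm g)\<^sup>2"
    using s bound unfolding ell2_def by (intro suminf_le_const) auto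
  then show "ell2_norm (f + g) \<le> ell2_norm f + ell2_norm g"
    unfolding ell2_norm_def[of "f + g"] using nn s by (auto intro!: real_le_lsqrt)
qed

lemma Metric_space_ell2:
  "Metric_space (ell2 :: (nat \<Rightarrow> 'k::real_normed_field) set) (\<lambda>f g. ell2_norm (f - g))"
proof -
  have neg: "- f \<in> ell2" if "f \<in> ell2" for f :: "nat \<Rightarrow> 'k"
    using that by (simp add: ell2_def)
  have diff: "f - g \<in> ell2" if "f \<in> ell2" "g \<in> ell2" for f g :: "nat \<Rightarrow> 'k"
    using ell2_add(1)[OF that(1) neg[OF that(2)]] by simp
  show ?thesis
  proof
    fix f g h :: "nat \<Rightarrow> 'k"
    show "0 \<le> ell2_norm (f - g)"
      by (simp add: ell2_norm_def ell2_def suminf_nonneg)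
    show "ell2_norm (f - g) = ell2_norm (g - f)"
      by (simp add: ell2_norm_def ell2_def norm_minus_commute)
    assume fg: "f \<in> ell2" "g \<in> ell2"
    have "summable (\<lambda>n. (norm ((f - g) n))\<^sup>2)"
      using diff[OF fg] by (simp only: ell2_def mem_Collect_eq)
    then show "(ell2_norm (f - g) = 0) = (f = g)"
      by (auto simp: ell2_norm_def ell2_def suminf_eq_zero_iff fun_eq_iff)
    assume h: "h \<in> ell2"
    show "ell2_norm (f - h) \<le> ell2_norm (f - g) + ell2_norm (g - h)"
      using ell2_add(2)[OF diff[OF fg] diff[OF fg(2) h]] by simp
  qed
qed

end

theory Submission
  imports Defs
begin

text \<open>
  The theorem rests on the fact that, unless the space is isomorphic to \<open>\<ell>\<^sub>2\<close>, every
  surjective linear isometry maps each \<open>e n\<close> to a multiple of some \<open>e k\<close> by a scalar of modulus 1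
  (\<open>Iso_e\<close>). Reflexivity follows from it easily (\<open>local_isometry_Iso\<close>). An operator \<open>T\<close> that agrees
  with an isometry at each single vector satisfies \<open>T (e n) = \<epsilon> n e (\<pi> n)\<close> with unimodular
  \<open>\<epsilon> n\<close>. Its values at \<open>e n + e m\<close> show that \<open>\<pi>\<close> is injective, and its value at a vector without
  zero coordinates shows that \<open>\<pi>\<close> is surjective. By the symmetry of the basis, such an operator is
  a surjective isometry.

  To describe the isometries, one studies the isometric reflections \<open>x - 2 f(x) v\<close> with \<open>f(v) = 1\<close>.
  Changing the sign of the coordinate \<open>n\<close> is the reflection given by \<open>e n\<close> and the coordinate functional,
  and conjugation by an isometry \<open>T\<close> turns it into the one given by \<open>T (e n)\<close>. The product of two
  isometric reflections \<open>(v, f)\<close> and \<open>(w, g)\<close> acts as a rotation on a plane; as its powers are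
  isometries, they are bounded, and so the squared cosine \<open>f(w) g(v)\<close> is a real number in \<open>[0, 1]\<close>
  (\<open>reflection_angle\<close>). This single fact, applied to \<open>v\<close> and its images under permutations and
  changes of phase of the coordinates, yields that \<open>f\<close> is a multiple of the inner product with \<open>v\<close>
  (\<open>reflection_coord\<close>, \<open>reflection_proportional\<close>). In particular the weights
  \<open>\<bar>f (e k)\<bar> \<bar>v\<^sub>k\<bar>\<close> sum up to 1.

  Suppose that some isometry is not of the claimed form. Then some isometric reflection has a weight
  different from 0, 1/2 and 1 (\<open>ex_reflection_generic_weight\<close>). As there are infinitely many
  coordinates, one finds isometric reflections that move \<open>e 0\<close> off its line by an arbitrarily small
  amount (\<open>ex_small_reflection\<close>), and so isometric rotations by arbitrarily small angles. Their powers approximate every rotation in the plane of two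
  basis vectors (\<open>fnorm_rotation_limit\<close>). Turning the coordinates one by one into the first axis, one
  sees that the F-norm of a finitely supported vector depends only on its Euclidean norm (\<open>fnorm_sum\<close>).
  Completeness then makes the coordinate map an isomorphism onto \<open>\<ell>\<^sub>2\<close>.

  Real and complex scalars are treated together. In both fields, the values of all
  Chebyshev polynomials at a point are bounded only if the point lies in the real interval \<open>[-1, 1]\<close>;
  it is this property (\<open>chebyshev_field\<close>) that makes squared cosines real.
\<close>

section \<open>Convergence in F-normed spaces\<close>

context F_normed_space
begin

definition fconv :: "(nat \<Rightarrow> 'a) \<Rightarrow> 'a \<Rightarrow> bool"
  where "fconv X x \<longleftrightarrow> (\<lambda>i. fnorm (X i - x)) \<longlonglongrightarrow> 0"

lemma fnorm_zero [simp]: "fnorm 0 = 0"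
proof -
  interpret M: Metric_space UNIV "fdist fnorm" by (rule Metric_space_fdist)
  show ?thesis using M.mdist_zero[of 0] by (simp add: fdist_def)
qed

lemma fnorm_eq_zero_iff: "fnorm x = 0 \<longleftrightarrow> x = 0"
  by (metis fnorm_pos fnorm_zero less_irrefl)

lemma fnorm_minus [simp]: "fnorm (- x) = fnorm x"
  using fnorm_smul_le[of "-1" x] fnorm_smul_le[of "-1" "- x"] by simp

lemma fnorm_diff_commute: "fnorm (x - y) = fnorm (y - x)"
  using fnorm_minus[of "x - y"] by simp

lemma fnorm_triangle_diff: "fnorm (x - y) \<le> fnorm x + fnorm y"
  using fnorm_triangle[of x "- y"] by simp

lemma fnorm_diff_triangle: "fnorm (x - z) \<le> fnorm (x - y) + fnorm (y - z)"
  using fnorm_triangle[of "x - y" "y - z"] by simp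

lemma abs_fnorm_diff_le: "\<bar>fnorm x - fnorm y\<bar> \<le> fnorm (x - y)"
  using fnorm_triangle[of "x - y" y] fnorm_triangle[of "y - x" x] fnorm_diff_commute[of x y]
  by simp

lemma fnorm_smul_mono:
  assumes "norm a \<le> norm b"
  shows "fnorm (smul a x) \<le> fnorm (smul b x)"
proof (cases "b = 0")
  case False
  have "norm (a / b) \<le> 1"
    using assms False by (simp add: norm_divide)
  then have "fnorm (smul (a / b) (smul b x)) \<le> fnorm (smul b x)"
    by (rule fnorm_smul_le)
  with False show ?thesis by simp
qed (use assms in simp)

lemma fnorm_smul_cong: "norm a = norm b \<Longrightarrow> fnorm (smul a x) = fnorm (smul b x)"
  by (intro antisym fnorm_smul_mono) auto

lemma fnorm_smul_of_nat_le: "fnorm (smul (of_nat n) x) \<le> real n * fnorm x"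
proof (induction n)
  case (Suc n)
  have "fnorm (smul (of_nat (Suc n)) x) \<le> fnorm x + fnorm (smul (of_nat n) x)"
    using fnorm_triangle[of x "smul (of_nat n) x"] by (simp add: scale_left_distrib)
  with Suc show ?case by (simp add: algebra_simps)
qed simp

lemma limitin_ftopology_iff: "limitin (ftopology fnorm) X x sequentially \<longleftrightarrow> fconv X x"
proof -
  interpret M: Metric_space UNIV "fdist fnorm" by (rule Metric_space_fdist)
  show ?thesis
    unfolding ftopology_def fconv_def M.limitin_metric_dist_null by (simp add: fdist_def)
qed

lemma fconv_const [simp]: "fconv (\<lambda>i. x) x"
  by (simp add: fconv_def)

lemma fconv_unique:
  assumes "fconv X x" "fconv X y"
  shows "x = y"
proof -
  have "(\<lambda>i. fnorm (X i - x) + fnorm (X i - y)) \<longlonglongrightarrow> 0 + 0"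
    using assms unfolding fconv_def by (intro tendsto_add)
  moreover have "fnorm (x - y) \<le> fnorm (X i - x) + fnorm (X i - y)" for i
    using fnorm_triangle[of "x - X i" "X i - y"] fnorm_diff_commute[of x "X i"] by simp
  ultimately have "fnorm (x - y) \<le> 0"
    by (intro LIMSEQ_le_const[of _ 0]) auto
  then show ?thesis
    using fnorm_nonneg[of "x - y"] fnorm_eq_zero_iff[of "x - y"] by simp
qed

lemma fconv_squeeze:
  assumes "\<And>i. fnorm (X i - x) \<le> b i" "b \<longlonglongrightarrow> 0"
  shows "fconv X x"
  unfolding fconv_def
  by (rule tendsto_sandwich[OF _ _ tendsto_const assms(2)]) (auto simp: fnorm_nonneg assms)

lemma fconv_add:
  assumes "fconv X x" "fconv Y y"
  shows "fconv (\<lambda>i. X i + Y i) (x + y)"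
proof (rule fconv_squeeze)
  show "fnorm (X i + Y i - (x + y)) \<le> fnorm (X i - x) + fnorm (Y i - y)" for i
    using fnorm_triangle[of "X i - x" "Y i - y"] by (simp add: algebra_simps)
  show "(\<lambda>i. fnorm (X i - x) + fnorm (Y i - y)) \<longlonglongrightarrow> 0"
    using tendsto_add[OF assms[unfolded fconv_def]] by simp
qed

lemma fconv_minus: "fconv X x \<Longrightarrow> fconv (\<lambda>i. - X i) (- x)"
  unfolding fconv_def using fnorm_diff_commute by (simp add: add.commute)

lemma fconv_diff: "fconv X x \<Longrightarrow> fconv Y y \<Longrightarrow> fconv (\<lambda>i. X i - Y i) (x - y)"
  using fconv_add[OF _ fconv_minus, of X x Y y] by simp

lemma fconv_fnorm: "fconv X x \<Longrightarrow> (\<lambda>i. fnorm (X i)) \<longlonglongrightarrow> fnorm x"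
  unfolding fconv_def
  by (erule metric_tendsto_imp_tendsto) (simp add: dist_real_def abs_fnorm_diff_le fnorm_nonneg)

text \<open>Scalar multiplication is jointly continuous: a convergent sequence of scalars is bounded by
  a natural number, and multiplication by a natural number is Lipschitz.\<close>
lemma fconv_smul:
  assumes "c \<longlonglongrightarrow> a" "fconv X x"
  shows "fconv (\<lambda>i. smul (c i) (X i)) (smul a x)"
proof -
  have "Bseq c"
    using assms(1) by (simp add: convergentI convergent_imp_Bseq)
  then obtain K where "\<forall>i. norm (c i) \<le> K"
    by (auto simp: Bseq_def)
  note K = this[rule_format]
  define M where "M = nat \<lceil>K\<rceil>"
  have M: "norm (c i) \<le> real M" for i
    using K[of i] unfolding M_def by linarith
  let ?b = "\<lambda>i. real M * fnorm (X i - x) + fnorm (smul (c i - a) x)"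
  have b: "fnorm (smul (c i) (X i) - smul a x) \<le> ?b i" for i
  proof -
    have "smul (c i) (X i) - smul a x = smul (c i) (X i - x) + smul (c i - a) x"
      by (simp add: scale_right_diff_distrib scale_left_diff_distrib)
    moreover have "fnorm (smul (c i) (X i - x)) \<le> fnorm (smul (of_nat M) (X i - x))"
      using M by (intro fnorm_smul_mono) simp
    ultimately show ?thesis
      using fnorm_triangle[of "smul (c i) (X i - x)" "smul (c i - a) x"]
        fnorm_smul_of_nat_le[of M "X i - x"] by simp
  qed
  have "isCont (\<lambda>a. fnorm (smul a x)) 0"
    using fnorm_smul_tendsto[of x] by (simp add: isCont_def)
  moreover have "(\<lambda>i. c i - a) \<longlonglongrightarrow> 0"
    using assms(1) by (simp add: LIM_zero)
  ultimately have "(\<lambda>i. fnorm (smul (c i - a) x)) \<longlonglongrightarrow> fnorm (smul 0 x)"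
    by (rule isCont_tendsto_compose)
  then have "?b \<longlonglongrightarrow> 0"
    using tendsto_add[OF tendsto_mult_right_zero[OF assms(2)[unfolded fconv_def], of "real M"]]
    by simp
  with b show ?thesis by (rule fconv_squeeze)
qed

lemma smul_tendsto_zero_iff:
  assumes "x \<noteq> 0"
  shows "(\<lambda>i. fnorm (smul (c i) x)) \<longlonglongrightarrow> 0 \<longleftrightarrow> c \<longlonglongrightarrow> 0"
proof
  assume lim: "(\<lambda>i. fnorm (smul (c i) x)) \<longlonglongrightarrow> 0"
  show "c \<longlonglongrightarrow> 0"
  proof (rule tendstoI)
    fix d :: real assume d: "d > 0"
    have "0 < fnorm (smul (of_real d) x)"
      using assms d by (intro fnorm_pos) simp
    with lim have "eventually (\<lambda>i. fnorm (smul (c i) x) < fnorm (smul (of_real d) x)) sequentially"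
      by (rule order_tendstoD)
    then show "eventually (\<lambda>i. dist (c i) 0 < d) sequentially"
    proof eventually_elim
      case (elim i)
      then show ?case
        using fnorm_smul_mono[of "of_real d" "c i" x] d by (force simp: not_less)
    qed
  qed
next
  assume "c \<longlonglongrightarrow> 0"
  from fconv_smul[OF this fconv_const[of x]] show "(\<lambda>i. fnorm (smul (c i) x)) \<longlonglongrightarrow> 0"
    by (simp add: fconv_def)
qed

section \<open>Linear isometries and isometric reflections\<close>

lemma vector_space_smul: "vector_space smul" ..

lemma Iso_iff:
  "T \<in> Iso smul fnorm \<longleftrightarrow> (\<forall>x y. T (x + y) = T x + T y) \<and> (\<forall>a x. T (smul a x) = smul a (T x)) \<and>
     surj T \<and> (\<forall>x. fnorm (T x) = fnorm x)"
  unfolding Iso_def Vector_Spaces.linear_iff using vector_space_smul by auto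

lemma Iso_add: "T \<in> Iso smul fnorm \<Longrightarrow> T (x + y) = T x + T y"
  and Iso_smul: "T \<in> Iso smul fnorm \<Longrightarrow> T (smul a x) = smul a (T x)"
  and Iso_fnorm: "T \<in> Iso smul fnorm \<Longrightarrow> fnorm (T x) = fnorm x"
  and Iso_surj: "T \<in> Iso smul fnorm \<Longrightarrow> surj T"
  by (auto simp: Iso_iff)

lemma Iso_zero: "T \<in> Iso smul fnorm \<Longrightarrow> T 0 = 0"
  using Iso_smul[of T 0 0] by simp

lemma Iso_minus: "T \<in> Iso smul fnorm \<Longrightarrow> T (- x) = - T x"
  using Iso_smul[of T "-1" x] by simp

lemma Iso_diff: "T \<in> Iso smul fnorm \<Longrightarrow> T (x - y) = T x - T y"
  using Iso_add[of T x "- y"] Iso_minus[of T y] by simp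

lemma Iso_sum: "T \<in> Iso smul fnorm \<Longrightarrow> T (\<Sum>i\<in>A. g i) = (\<Sum>i\<in>A. T (g i))"
  by (induction A rule: infinite_finite_induct) (simp_all add: Iso_zero Iso_add)

lemma Iso_bij: "T \<in> Iso smul fnorm \<Longrightarrow> bij T"
proof (rule bijI)
  assume T: "T \<in> Iso smul fnorm"
  show "inj T"
  proof (rule injI)
    fix x y assume "T x = T y"
    then have "fnorm (x - y) = 0"
      using Iso_fnorm[OF T, of "x - y"] Iso_diff[OF T] by simp
    then show "x = y" by (simp add: fnorm_eq_zero_iff)
  qed
  show "surj T" using T by (rule Iso_surj)
qed

lemma Iso_inv [intro]:
  assumes T: "T \<in> Iso smul fnorm"
  shows "inv T \<in> Iso smul fnorm"
proof -
  have [simp]: "T (inv T x) = x" "inv T (T x) = x" for x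
    using Iso_bij[OF T] by (simp_all add: bij_is_surj surj_f_inv_f bij_is_inj)
  have inj: "x = y" if "T x = T y" for x y
    using Iso_bij[OF T] that by (simp add: bij_is_inj inj_eq)
  have "inv T (x + y) = inv T x + inv T y" for x y
    by (rule inj) (simp add: Iso_add[OF T])
  moreover have "inv T (smul a x) = smul a (inv T x)" for a x
    by (rule inj) (simp add: Iso_smul[OF T])
  moreover have "fnorm (inv T x) = fnorm x" for x
    using Iso_fnorm[OF T, of "inv T x"] by simp
  moreover have "surj (inv T)"
    using Iso_bij[OF T] by (simp add: bij_imp_bij_inv bij_is_surj)
  ultimately show ?thesis by (simp add: Iso_iff)
qed

lemma Iso_inv_cancel [simp]:
  assumes "T \<in> Iso smul fnorm"
  shows "T (inv T x) = x" "inv T (T x) = x"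
  using Iso_bij[OF assms] by (simp_all add: bij_is_surj surj_f_inv_f bij_is_inj)

definition isometric_reflection :: "'a \<Rightarrow> ('a \<Rightarrow> 'k) \<Rightarrow> bool"
  where "isometric_reflection v f \<longleftrightarrow>
    (\<forall>x y. f (x + y) = f x + f y) \<and> (\<forall>a x. f (smul a x) = a * f x) \<and> f v = 1 \<and>
    (\<forall>x. fnorm (x - smul (2 * f x) v) = fnorm x)"

definition reflect :: "'a \<Rightarrow> ('a \<Rightarrow> 'k) \<Rightarrow> 'a \<Rightarrow> 'a"
  where "reflect v f x = x - smul (2 * f x) v"

lemma reflection_add: "isometric_reflection v f \<Longrightarrow> f (x + y) = f x + f y"
  and reflection_smul: "isometric_reflection v f \<Longrightarrow> f (smul a x) = a * f x"
  and reflection_self: "isometric_reflection v f \<Longrightarrow> f v = 1"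
  by (auto simp: isometric_reflection_def)

lemma reflection_zero: "isometric_reflection v f \<Longrightarrow> f 0 = 0"
  using reflection_smul[of v f 0 0] by simp

lemma reflection_minus: "isometric_reflection v f \<Longrightarrow> f (- x) = - f x"
  using reflection_smul[of v f "-1" x] by simp

lemma reflection_diff: "isometric_reflection v f \<Longrightarrow> f (x - y) = f x - f y"
  using reflection_add[of v f x "- y"] reflection_minus[of v f y] by simp

lemma reflection_sum: "isometric_reflection v f \<Longrightarrow> f (\<Sum>i\<in>A. g i) = (\<Sum>i\<in>A. f (g i))"
  by (induction A rule: infinite_finite_induct) (simp_all add: reflection_zero reflection_add)

lemma reflection_nonzero: "isometric_reflection v f \<Longrightarrow> v \<noteq> 0"
  using reflection_self[of v f] reflection_zero[of v f] by auto

lemma reflect_reflect: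
  assumes "isometric_reflection v f"
  shows "reflect v f (reflect v f x) = x"
  using reflection_diff[OF assms] reflection_smul[OF assms] reflection_self[OF assms]
  unfolding reflect_def by (simp add: scale_left_diff_distrib flip: scale_left_distrib)

lemma reflect_Iso:
  assumes "isometric_reflection v f"
  shows "reflect v f \<in> Iso smul fnorm"
proof -
  have "surj (reflect v f)"
    using reflect_reflect[OF assms] by (metis surjI)
  then show ?thesis
    unfolding Iso_iff
    using assms reflection_add[OF assms] reflection_smul[OF assms]
    by (auto simp: reflect_def isometric_reflection_def algebra_simps)
qed

lemma inv_reflect: "isometric_reflection v f \<Longrightarrow> inv (reflect v f) = reflect v f"
  by (rule inv_equality) (auto simp: reflect_reflect)

lemma reflection_conj:
  assumes T: "T \<in> Iso smul fnorm" and r: "isometric_reflection v f"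
  shows "isometric_reflection (T v) (\<lambda>x. f (inv T x))"
proof -
  have "fnorm (x - smul (2 * f (inv T x)) (T v)) = fnorm x" for x
  proof -
    have "x - smul (2 * f (inv T x)) (T v) = T (reflect v f (inv T x))"
      using T by (simp add: reflect_def Iso_diff Iso_smul)
    also have "fnorm \<dots> = fnorm (inv T x)"
      using reflect_Iso[OF r] by (simp add: Iso_fnorm T)
    finally show ?thesis using Iso_fnorm[OF Iso_inv[OF T]] by simp
  qed
  with T r show ?thesis
    using Iso_add[OF Iso_inv[OF T]] Iso_smul[OF Iso_inv[OF T]]
    by (simp add: isometric_reflection_def)
qed

text \<open>The functional of an isometric reflection is continuous, since
  \<open>2 f x v\<close> is the difference of \<open>x\<close> and a vector of the same F-norm.\<close>
lemma fnorm_reflection_le: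
  assumes "isometric_reflection v f"
  shows "fnorm (smul (2 * f x) v) \<le> 2 * fnorm x"
proof -
  have "smul (2 * f x) v = x - reflect v f x" by (simp add: reflect_def)
  then show ?thesis
    using fnorm_triangle_diff[of x "reflect v f x"] Iso_fnorm[OF reflect_Iso[OF assms]] by simp
qed

lemma reflection_fconv:
  assumes r: "isometric_reflection v f" and "fconv X x"
  shows "(\<lambda>i. f (X i)) \<longlonglongrightarrow> f x"
proof -
  have "fnorm (smul (2 * f (X i - x)) v) \<le> 2 * fnorm (X i - x)" for i
    by (rule fnorm_reflection_le[OF r])
  then have "fconv (\<lambda>i. smul (2 * f (X i - x)) v) 0"
    using tendsto_mult_right_zero[OF assms(2)[unfolded fconv_def], of 2]
    by (intro fconv_squeeze[of _ _ "\<lambda>i. 2 * fnorm (X i - x)"]) simp_all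
  then have "(\<lambda>i. fnorm (smul (2 * f (X i - x)) v)) \<longlonglongrightarrow> 0"
    by (simp add: fconv_def)
  then have "(\<lambda>i. 2 * f (X i - x)) \<longlonglongrightarrow> 0"
    using smul_tendsto_zero_iff[OF reflection_nonzero[OF r]] by blast
  then have "(\<lambda>i. inverse 2 * (2 * f (X i - x))) \<longlonglongrightarrow> 0"
    by (rule tendsto_mult_right_zero)
  moreover have "inverse 2 * (2 * f (X i - x)) = f (X i) - f x" for i
    by (simp add: reflection_diff[OF r] flip: mult.assoc)
  ultimately show ?thesis
    by (simp add: LIM_zero_cancel)
qed

text \<open>Orbits are bounded in the sense of topological vector spaces: a small multiple of \<open>A n x\<close> is the
  image of a small multiple of \<open>x\<close>, and this smallness does not depend on \<open>n\<close>.\<close>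
lemma reflection_bounded_on_orbit:
  assumes r: "isometric_reflection v f" and A: "\<And>n. A n \<in> Iso smul fnorm"
  obtains M where "\<And>n. norm (f (A n x)) \<le> M"
proof -
  have "((\<lambda>a. fnorm (smul a x)) \<longlongrightarrow> 0) (nhds 0)"
    using fnorm_smul_tendsto[of x] tendsto_at_iff_tendsto_nhds[of "\<lambda>a. fnorm (smul a x)" 0] by simp
  moreover have "0 < fnorm v / 2"
    using fnorm_pos[OF reflection_nonzero[OF r]] by simp
  ultimately have "eventually (\<lambda>a. fnorm (smul a x) < fnorm v / 2) (nhds 0)"
    by (rule order_tendstoD)
  then obtain d where d: "d > 0" and small: "\<And>a. norm a < d \<Longrightarrow> fnorm (smul a x) < fnorm v / 2"
    by (auto simp: eventually_nhds_metric)
  have "norm (f (A n x)) \<le> 1 / d" for n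
  proof (rule ccontr)
    assume "\<not> norm (f (A n x)) \<le> 1 / d"
    then have big: "norm (f (A n x)) > 1 / d" by simp
    define a where "a = inverse (2 * f (A n x))"
    have pos: "norm (f (A n x)) > 0"
      using big d by (meson divide_pos_pos less_trans zero_less_one)
    then have n0: "f (A n x) \<noteq> 0" by auto
    have "norm a < d"
    proof -
      have "norm a = inverse (2 * norm (f (A n x)))"
        by (simp add: a_def norm_mult norm_inverse)
      also have "\<dots> < d"
      proof -
        have "1 < d * norm (f (A n x))" using big d by (simp add: field_simps)
        then have "1 < d * (2 * norm (f (A n x)))" using d pos by simp
        then show ?thesis using pos by (simp add: inverse_eq_divide divide_less_eq)
      qed
      finally show ?thesis .
    qed
    have "smul (2 * f (A n (smul a x))) v = v"
      using n0 by (simp add: Iso_smul[OF A] reflection_smul[OF r] a_def)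
    with fnorm_reflection_le[OF r, of "A n (smul a x)"]
    have "fnorm v \<le> 2 * fnorm (smul a x)" by (simp add: Iso_fnorm[OF A])
    with small[OF \<open>norm a < d\<close>] show False by simp
  qed
  then show ?thesis by (rule that)
qed

lemma Iso_comp:
  assumes "A \<in> Iso smul fnorm" "B \<in> Iso smul fnorm"
  shows "A \<circ> B \<in> Iso smul fnorm"
proof -
  have "surj (A \<circ> B)"
    using assms by (intro comp_surj Iso_surj)
  then show ?thesis using assms by (simp add: Iso_iff)
qed

lemma Iso_id: "id \<in> Iso smul fnorm"
  by (simp add: Iso_iff)

lemma Iso_funpow: "A \<in> Iso smul fnorm \<Longrightarrow> A ^^ n \<in> Iso smul fnorm"
  by (induction n) (simp_all add: Iso_comp Iso_id)

end

text \<open>The sequence \<open>x\<close> consists of the values \<open>T\<^sub>n y\<close> of the Chebyshev polynomials at \<open>y = x 1\<close>.\<close>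
definition chebyshev_field :: "'k::real_normed_field itself \<Rightarrow> bool"
  where "chebyshev_field _ \<longleftrightarrow>
    (\<forall>(x :: nat \<Rightarrow> 'k) M. x 0 = 1 \<longrightarrow> (\<forall>n. x (n + 2) = 2 * x 1 * x (n + 1) - x n) \<longrightarrow>
       (\<forall>n. norm (x n) \<le> M) \<longrightarrow> (\<exists>r. -1 \<le> r \<and> r \<le> 1 \<and> x 1 = of_real r))"

text \<open>Write \<open>x 1 = (z + 1/z) / 2\<close>; then \<open>x n = (z^n + 1/z^n) / 2\<close>, which is bounded only if
  \<open>z\<close> lies on the unit circle, and then \<open>x 1\<close> is the real part of \<open>z\<close>.\<close>
lemma chebyshev_field_complex: "chebyshev_field TYPE(complex)"
  unfolding chebyshev_field_def
proof (intro allI impI)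
  fix x :: "nat \<Rightarrow> complex" and M
  assume x0: "x 0 = 1" and rec: "\<forall>n. x (n + 2) = 2 * x 1 * x (n + 1) - x n"
    and bdd: "\<forall>n. norm (x n) \<le> M"
  define s where "s = csqrt ((x 1)\<^sup>2 - 1)"
  have s2: "s\<^sup>2 = (x 1)\<^sup>2 - 1" by (simp add: s_def)
  have cheb: "2 * x n = z ^ n + w ^ n" if zw: "z * w = 1" "z + w = 2 * x 1" for z w n
  proof (induction n rule: induct_nat_012)
    case (ge2 n)
    have "x (Suc (Suc n)) = 2 * x 1 * x (Suc n) - x n"
      using rec[rule_format, of n] by simp
    then have "2 * x (Suc (Suc n)) = (2 * x 1) * (2 * x (Suc n)) - 1 * (2 * x n)"
      by (simp only: right_diff_distrib mult.assoc mult_1_left mult.left_commute)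
    also have "\<dots> = (z + w) * (z ^ Suc n + w ^ Suc n) - (z * w) * (z ^ n + w ^ n)"
      by (simp only: ge2 zw)
    finally show ?case by (simp add: algebra_simps)
  qed (use x0 zw in auto)
  have le1: "norm z \<le> 1" if zw: "z * w = 1" "z + w = 2 * x 1" for z w :: complex
  proof (rule ccontr)
    assume "\<not> norm z \<le> 1"
    then have z1: "norm z > 1" by simp
    have "norm w * norm z = 1" using zw(1) by (metis mult.commute norm_mult norm_one)
    moreover have "norm w * 1 \<le> norm w * norm z"
      using z1 by (intro mult_left_mono) auto
    ultimately have "norm w \<le> 1" by simp
    then have w: "norm (w ^ n) \<le> 1" for n by (simp add: norm_power power_le_one)
    obtain n where "norm z ^ n > 2 * M + 1"
      using real_arch_pow[OF z1] by blast
    moreover have "norm (z ^ n) \<le> norm (2 * x n) + norm (w ^ n)"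
      using norm_triangle_ineq4[of "2 * x n" "w ^ n"] by (simp add: cheb[OF zw])
    ultimately show False
      using w[of n] bdd[rule_format, of n] by (simp add: norm_mult norm_power)
  qed
  define z where "z = x 1 + s"
  define w where "w = x 1 - s"
  have zw: "z * w = 1" "z + w = 2 * x 1"
    using s2 by (simp_all add: z_def w_def algebra_simps power2_eq_square)
  have "norm z \<le> 1" "norm w \<le> 1"
    using le1[OF zw] le1[of w z] zw by (simp_all add: ac_simps)
  moreover have "norm z * norm w = 1" using zw(1) by (metis norm_mult norm_one)
  ultimately have nz: "norm z = 1"
    using mult_left_le[of "norm w" "norm z"] by simp
  then have "z * cnj z = z * w"
    using complex_norm_square[of z] zw(1) by simp
  moreover have "z \<noteq> 0" using nz by auto
  ultimately have "w = cnj z" by simp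
  then have "2 * x 1 = 2 * complex_of_real (Re z)"
    using zw(2) by (simp add: complex_add_cnj)
  then have "x 1 = of_real (Re z)" by simp
  moreover have "\<bar>Re z\<bar> \<le> 1" using abs_Re_le_cmod[of z] nz by simp
  ultimately show "\<exists>r. -1 \<le> r \<and> r \<le> 1 \<and> x 1 = of_real r" by (intro exI[of _ "Re z"]) auto
qed

lemma chebyshev_field_real: "chebyshev_field TYPE(real)"
  unfolding chebyshev_field_def
proof (intro allI impI)
  fix x :: "nat \<Rightarrow> real" and M
  assume x0: "x 0 = 1" and rec: "\<forall>n. x (n + 2) = 2 * x 1 * x (n + 1) - x n"
    and bdd: "\<forall>n. norm (x n) \<le> M"
  have "complex_of_real (x (n + 2)) =
      2 * complex_of_real (x 1) * complex_of_real (x (n + 1)) - complex_of_real (x n)" for n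
    unfolding rec[rule_format, of n] by simp
  moreover have "norm (complex_of_real (x n)) \<le> M" for n
    using bdd[rule_format, of n] by simp
  ultimately have "\<exists>r. -1 \<le> r \<and> r \<le> 1 \<and> complex_of_real (x 1) = of_real r"
    using chebyshev_field_complex[unfolded chebyshev_field_def, THEN spec,
        of "\<lambda>n. complex_of_real (x n)", THEN spec, of M] x0 by auto
  then show "\<exists>r. -1 \<le> r \<and> r \<le> 1 \<and> x 1 = of_real r" by auto
qed

context F_normed_space
begin

text \<open>Two isometric reflections compose to a rotation of the plane of their vectors: the vectors
  \<open>v\<close>, \<open>A v\<close>, \<open>A\<^sup>2 v\<close>, \<dots> have Chebyshev polynomials of \<open>2 c - 1\<close> as values of \<open>f\<close>, where
  \<open>c = f w * g v\<close> is the squared cosine of the angle. They are bounded, so that \<open>c\<close> is indeed a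
  real number in the unit interval.\<close>
lemma reflection_angle:
  assumes field: "chebyshev_field TYPE('k)"
    and r: "isometric_reflection v f" "isometric_reflection w g"
  shows "\<exists>t. 0 \<le> t \<and> t \<le> 1 \<and> f w * g v = of_real t"
proof -
  define c where "c = f w * g v"
  define A where "A = reflect v f \<circ> reflect w g"
  have A: "A \<in> Iso smul fnorm"
    unfolding A_def by (intro Iso_comp reflect_Iso r)
  note An = Iso_funpow[OF A]
  define x where "x n = f ((A ^^ n) v)" for n
  note fs = reflection_add[OF r(1)] reflection_smul[OF r(1)] reflection_diff[OF r(1)]
    reflection_self[OF r(1)] reflection_minus[OF r(1)]
  note gs = reflection_add[OF r(2)] reflection_smul[OF r(2)] reflection_diff[OF r(2)]
    reflection_self[OF r(2)] reflection_minus[OF r(2)]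
  have Av: "A v = smul (4 * c - 1) v - smul (2 * g v) w"
  proof -
    define k where "k = 2 * (1 - 2 * g v * f w)"
    have "A v = v - smul k v - smul (2 * g v) w"
      by (simp add: A_def reflect_def fs k_def algebra_simps)
    also have "v - smul k v = smul (1 - k) v"
      by (simp add: scale_left_diff_distrib)
    also have "1 - k = 4 * c - 1"
      by (simp add: k_def c_def algebra_simps)
    finally show ?thesis .
  qed
  have "reflect w g w = - w"
    using scale_left_distrib[of 1 1 w] by (simp add: reflect_def gs)
  then have Aw: "A w = smul (2 * f w) v - w"
    by (simp add: A_def reflect_def fs)
  have AA: "A (A v) = smul (4 * c - 2) (A v) - v"
  proof -
    have "A (A v) = smul (4 * c - 1) (A v) - smul (2 * g v) (A w)"
      using arg_cong[OF Av, of A] by (simp only: Iso_diff[OF A] Iso_smul[OF A])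
    also have "smul (2 * g v) (A w) = smul (4 * c) v - smul (2 * g v) w"
      by (simp add: Aw scale_right_diff_distrib c_def mult_ac)
    also have "\<dots> = A v + v"
      by (simp add: Av scale_left_diff_distrib)
    finally show ?thesis
      using scale_left_distrib[of 1 1 "A v"] by (simp add: scale_left_diff_distrib)
  qed
  have x0: "x 0 = 1" and x1: "x 1 = 2 * c - 1"
    by (simp_all add: x_def fs Av c_def)
  have rec: "x (n + 2) = 2 * x 1 * x (n + 1) - x n" for n
  proof -
    have "x (n + 2) = f ((A ^^ n) (A (A v)))"
      by (simp add: x_def funpow_swap1)
    also have "\<dots> = (4 * c - 2) * f ((A ^^ n) (A v)) - f ((A ^^ n) v)"
      by (simp add: AA Iso_diff[OF An] Iso_smul[OF An] fs)
    also have "\<dots> = (4 * c - 2) * x (n + 1) - x n"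
      by (simp add: x_def funpow_swap1)
    finally show ?thesis unfolding x1 by (simp add: algebra_simps)
  qed
  obtain M where M: "\<And>n. norm (x n) \<le> M"
    using reflection_bounded_on_orbit[of v f "\<lambda>n. A ^^ n" v, OF r(1) An] unfolding x_def by metis
  \<comment> \<open>\<open>x 1 = 2 c - 1\<close> is the cosine of the angle of the rotation, twice the angle of the vectors\<close>
  have "\<exists>s. -1 \<le> s \<and> s \<le> 1 \<and> x 1 = of_real s"
    by (rule field[unfolded chebyshev_field_def, rule_format, of x M, OF x0 rec M])
  then obtain s where s: "-1 \<le> s" "s \<le> 1" "x 1 = of_real s"
    by blast
  have "c = of_real ((s + 1) / 2)"
  proof -
    have "2 * c = of_real (s + 1)" using x1 s(3) by (simp add: algebra_simps)
    then show ?thesis by (simp add: field_simps)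
  qed
  with s show ?thesis unfolding c_def by (intro exI[of _ "(s + 1) / 2"]) auto
qed

end

section \<open>Symmetric bases\<close>

locale symmetric_basis_space = F_space smul fnorm
  for smul :: "'k::real_normed_field \<Rightarrow> 'a::ab_group_add \<Rightarrow> 'a" and fnorm :: "'a \<Rightarrow> real" +
  fixes e :: "nat \<Rightarrow> 'a"
  assumes basis_symmetric: "symmetric_basis smul fnorm e"
    and field: "chebyshev_field TYPE('k)"
begin

definition coord :: "nat \<Rightarrow> 'a \<Rightarrow> 'k"
  where "coord n x = (THE c. expansion smul fnorm e c x) n"

definition unimodular :: "(nat \<Rightarrow> 'k) \<Rightarrow> bool"
  where "unimodular \<epsilon> \<longleftrightarrow> (\<forall>n. norm (\<epsilon> n) = 1)"

lemma unimodular_nonzero: "unimodular \<epsilon> \<Longrightarrow> \<epsilon> n \<noteq> 0"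
  unfolding unimodular_def by (metis norm_zero zero_neq_one)

definition monomial :: "(nat \<Rightarrow> 'k) \<Rightarrow> (nat \<Rightarrow> nat) \<Rightarrow> 'a \<Rightarrow> 'a"
  where "monomial \<epsilon> \<pi> x =
    (SOME y. expansion smul fnorm (\<lambda>n. e (\<pi> n)) (\<lambda>n. \<epsilon> n * coord n x) y \<and> fnorm x = fnorm y)"

lemma expansion_iff: "expansion smul fnorm d c x \<longleftrightarrow> fconv (\<lambda>N. \<Sum>k<N. smul (c k) (d k)) x"
  unfolding expansion_def by (rule limitin_ftopology_iff)

lemma ex1_expansion: "\<exists>!c. expansion smul fnorm e c x"
  using basis_symmetric unfolding symmetric_basis_def basis_def by blast

lemma expansion_coord: "expansion smul fnorm e (\<lambda>n. coord n x) x"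
  unfolding coord_def using theI'[OF ex1_expansion[of x]] by simp

lemma coord_expansion: "fconv (\<lambda>N. \<Sum>k<N. smul (coord k x) (e k)) x"
  using expansion_coord by (simp add: expansion_iff)

lemma coord_unique:
  assumes "fconv (\<lambda>N. \<Sum>k<N. smul (c k) (e k)) x"
  shows "coord k x = c k"
proof -
  have "(\<lambda>n. coord n x) = c"
    using ex1_expansion[of x] expansion_coord[of x] assms unfolding expansion_iff[symmetric] by blast
  then show ?thesis by (simp add: fun_eq_iff)
qed

lemma coord_eqI: "(\<And>k. coord k x = coord k y) \<Longrightarrow> x = y"
  using coord_expansion[of x] coord_expansion[of y] fconv_unique by simp

lemma coord_add [simp]: "coord k (x + y) = coord k x + coord k y"
  using fconv_add[OF coord_expansion[of x] coord_expansion[of y]]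
  by (intro coord_unique) (simp add: scale_left_distrib sum.distrib)

lemma coord_smul [simp]: "coord k (smul a x) = a * coord k x"
  using fconv_smul[OF tendsto_const[of a] coord_expansion[of x]]
  by (intro coord_unique) (simp add: scale_sum_right)

lemma coord_zero [simp]: "coord k 0 = 0"
  using coord_smul[of k 0 0] by simp

lemma coord_minus [simp]: "coord k (- x) = - coord k x"
  using coord_smul[of k "-1" x] by simp

lemma coord_diff [simp]: "coord k (x - y) = coord k x - coord k y"
  using coord_add[of k x "- y"] by simp

lemma coord_sum [simp]: "coord k (\<Sum>i\<in>A. g i) = (\<Sum>i\<in>A. coord k (g i))"
  by (induction A rule: infinite_finite_induct) simp_all

lemma coord_e: "coord k (e n) = (if k = n then 1 else 0)"
proof (rule coord_unique)
  have "(\<Sum>k<N. smul (if k = n then 1 else 0) (e k)) = e n" if "n < N" for N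
  proof -
    have "(\<Sum>k<N. smul (if k = n then 1 else 0) (e k)) = (\<Sum>k<N. if k = n then e k else 0)"
      by (intro sum.cong) auto
    with that show ?thesis by simp
  qed
  then have "eventually (\<lambda>N. fnorm ((\<Sum>k<N. smul (if k = n then 1 else 0) (e k)) - e n) = 0) sequentially"
    by (intro eventually_sequentiallyI[of "Suc n"]) simp
  then show "fconv (\<lambda>N. \<Sum>k<N. smul (if k = n then 1 else 0) (e k)) (e n)"
    unfolding fconv_def by (rule tendsto_eventually)
qed

lemma coord_e_same [simp]: "coord k (e k) = 1"
  by (simp add: coord_e)

lemma e_nonzero [simp]: "e n \<noteq> 0"
  using coord_e_same[of n] by fastforce

context
  fixes \<epsilon> :: "nat \<Rightarrow> 'k" and \<pi> :: "nat \<Rightarrow> nat"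
  assumes unimodular: "unimodular \<epsilon>" and bij: "bij \<pi>"
begin

lemma monomial:
  shows monomial_expansion: "fconv (\<lambda>N. \<Sum>k<N. smul (\<epsilon> k * coord k x) (e (\<pi> k))) (monomial \<epsilon> \<pi> x)"
    and fnorm_monomial: "fnorm (monomial \<epsilon> \<pi> x) = fnorm x"
proof -
  have "\<exists>y. expansion smul fnorm (\<lambda>n. e (\<pi> n)) (\<lambda>n. \<epsilon> n * coord n x) y \<and> fnorm x = fnorm y"
    using basis_symmetric expansion_coord[of x] unimodular bij
    unfolding symmetric_basis_def unimodular_def by blast
  from someI_ex[OF this]
  show "fconv (\<lambda>N. \<Sum>k<N. smul (\<epsilon> k * coord k x) (e (\<pi> k))) (monomial \<epsilon> \<pi> x)"
    and "fnorm (monomial \<epsilon> \<pi> x) = fnorm x"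
    unfolding monomial_def[symmetric] by (simp_all add: expansion_iff)
qed

end

text \<open>The coordinate functionals are continuous because changing the sign of a coordinate is an
  isometry.\<close>
lemma coord_reflection: "isometric_reflection (e n) (coord n)"
proof -
  define \<epsilon> :: "nat \<Rightarrow> 'k" where "\<epsilon> k = (if k = n then -1 else 1)" for k
  have \<epsilon>: "unimodular \<epsilon>" by (simp add: unimodular_def \<epsilon>_def)
  have "monomial \<epsilon> id x = x - smul (2 * coord n x) (e n)" for x
  proof (rule coord_eqI)
    fix k
    have "coord k (monomial \<epsilon> id x) = \<epsilon> k * coord k x"
      using monomial_expansion[of \<epsilon> id x] \<epsilon> by (intro coord_unique) simp
    then show "coord k (monomial \<epsilon> id x) = coord k (x - smul (2 * coord n x) (e n))"
      by (simp add: \<epsilon>_def coord_e)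
  qed
  then have "fnorm (x - smul (2 * coord n x) (e n)) = fnorm x" for x
    using fnorm_monomial[of \<epsilon> id x] \<epsilon> by simp
  then show ?thesis by (simp add: isometric_reflection_def)
qed

lemma coord_fconv: "fconv X x \<Longrightarrow> (\<lambda>i. coord n (X i)) \<longlonglongrightarrow> coord n x"
  by (rule reflection_fconv[OF coord_reflection])

context
  fixes \<epsilon> :: "nat \<Rightarrow> 'k" and \<pi> :: "nat \<Rightarrow> nat"
  assumes unimodular: "unimodular \<epsilon>" and bij: "bij \<pi>"
begin

lemma coord_monomial: "coord (\<pi> n) (monomial \<epsilon> \<pi> x) = \<epsilon> n * coord n x"
proof (rule LIMSEQ_unique)
  show "(\<lambda>N. coord (\<pi> n) (\<Sum>k<N. smul (\<epsilon> k * coord k x) (e (\<pi> k)))) \<longlonglongrightarrow> coord (\<pi> n) (monomial \<epsilon> \<pi> x)"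
    by (rule coord_fconv[OF monomial_expansion[OF unimodular bij]])
  have "coord (\<pi> n) (\<Sum>k<N. smul (\<epsilon> k * coord k x) (e (\<pi> k))) = \<epsilon> n * coord n x" if "n < N" for N
  proof -
    have "coord (\<pi> n) (\<Sum>k<N. smul (\<epsilon> k * coord k x) (e (\<pi> k))) =
        (\<Sum>k<N. \<epsilon> k * coord k x * (if n = k then 1 else 0))"
      using bij by (simp add: coord_e bij_is_inj inj_eq)
    also have "\<dots> = (\<Sum>k<N. if k = n then \<epsilon> n * coord n x else 0)"
      by (intro sum.cong) auto
    finally have "coord (\<pi> n) (\<Sum>k<N. smul (\<epsilon> k * coord k x) (e (\<pi> k))) =
        (\<Sum>k<N. if k = n then \<epsilon> n * coord n x else 0)" .
    with that show ?thesis by simp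
  qed
  then show "(\<lambda>N. coord (\<pi> n) (\<Sum>k<N. smul (\<epsilon> k * coord k x) (e (\<pi> k)))) \<longlonglongrightarrow> \<epsilon> n * coord n x"
    by (intro tendsto_eventually eventually_sequentiallyI[of "Suc n"]) simp
qed

lemma coord_eqI_bij: "(\<And>n. coord (\<pi> n) x = coord (\<pi> n) y) \<Longrightarrow> x = y"
  using bij by (metis coord_eqI bij_pointE)

lemma monomial_e: "monomial \<epsilon> \<pi> (e n) = smul (\<epsilon> n) (e (\<pi> n))"
  using bij by (intro coord_eqI_bij) (simp add: coord_monomial coord_e bij_is_inj inj_eq)

end

lemma monomial_Iso:
  assumes \<epsilon>: "unimodular \<epsilon>" and \<pi>: "bij \<pi>"
  shows "monomial \<epsilon> \<pi> \<in> Iso smul fnorm"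
proof -
  have "monomial \<epsilon> \<pi> (x + y) = monomial \<epsilon> \<pi> x + monomial \<epsilon> \<pi> y" for x y
    by (intro coord_eqI_bij[OF \<epsilon> \<pi>]) (simp add: coord_monomial[OF \<epsilon> \<pi>] algebra_simps)
  moreover have "monomial \<epsilon> \<pi> (smul a x) = smul a (monomial \<epsilon> \<pi> x)" for a x
    by (intro coord_eqI_bij[OF \<epsilon> \<pi>]) (simp add: coord_monomial[OF \<epsilon> \<pi>])
  moreover have "surj (monomial \<epsilon> \<pi>)"
  proof (rule surjI)
    fix y
    let ?\<epsilon> = "\<lambda>m. inverse (\<epsilon> (inv \<pi> m))"
    have u: "unimodular ?\<epsilon>"
      using \<epsilon> by (simp add: unimodular_def norm_inverse)
    note \<epsilon>0 = unimodular_nonzero[OF \<epsilon>]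
    have inv: "bij (inv \<pi>)" "inv \<pi> (\<pi> n) = n" for n
      using \<pi> by (simp_all add: bij_imp_bij_inv bij_is_inj)
    show "monomial \<epsilon> \<pi> (monomial ?\<epsilon> (inv \<pi>) y) = y"
    proof (rule coord_eqI_bij[OF \<epsilon> \<pi>])
      fix n
      show "coord (\<pi> n) (monomial \<epsilon> \<pi> (monomial ?\<epsilon> (inv \<pi>) y)) = coord (\<pi> n) y"
        using coord_monomial[OF u inv(1), where n = "\<pi> n" and x = y] by (simp add: coord_monomial[OF \<epsilon> \<pi>] inv \<epsilon>0)
    qed
  qed
  ultimately show ?thesis
    using fnorm_monomial[OF \<epsilon> \<pi>] by (simp add: Iso_iff)
qed

lemma fnorm_smul_e: "fnorm (smul a (e n)) = fnorm (smul a (e 0))"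
proof -
  have \<epsilon>: "unimodular (\<lambda>_. 1)" and \<pi>: "bij (Transposition.transpose 0 n)"
    by (simp_all add: unimodular_def)
  have "monomial (\<lambda>_. 1) (Transposition.transpose 0 n) (smul a (e 0)) = smul a (e n)"
    by (simp add: Iso_smul[OF monomial_Iso[OF \<epsilon> \<pi>]] monomial_e[OF \<epsilon> \<pi>])
  then show ?thesis using fnorm_monomial[OF \<epsilon> \<pi>, of "smul a (e 0)"] by simp
qed

text \<open>The terms of a convergent series tend to zero, and all basis vectors have the same F-norm.\<close>
lemma coord_tendsto_zero: "(\<lambda>k. coord k x) \<longlonglongrightarrow> 0"
proof -
  let ?S = "\<lambda>N. \<Sum>k<N. smul (coord k x) (e k)"
  have "fconv (\<lambda>N. ?S (Suc N)) x"
    using coord_expansion[of x] unfolding fconv_def by (rule LIMSEQ_Suc)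
  from fconv_diff[OF this coord_expansion[of x]]
  have "(\<lambda>N. fnorm (smul (coord N x) (e N))) \<longlonglongrightarrow> 0"
    by (simp add: fconv_def)
  moreover have "(\<lambda>N. fnorm (smul (coord N x) (e N))) = (\<lambda>N. fnorm (smul (coord N x) (e 0)))"
    by (rule ext) (rule fnorm_smul_e)
  ultimately show ?thesis by (simp add: smul_tendsto_zero_iff)
qed

lemma inv_monomial_e:
  assumes \<epsilon>: "unimodular \<epsilon>" and \<pi>: "bij \<pi>"
  shows "inv (monomial \<epsilon> \<pi>) (e (\<pi> n)) = smul (inverse (\<epsilon> n)) (e n)"
proof -
  note M = monomial_Iso[OF \<epsilon> \<pi>]
  have "\<epsilon> n \<noteq> 0" by (rule unimodular_nonzero[OF \<epsilon>])
  then have "monomial \<epsilon> \<pi> (smul (inverse (\<epsilon> n)) (e n)) = e (\<pi> n)"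
    by (simp add: Iso_smul[OF M] monomial_e[OF \<epsilon> \<pi>])
  then show ?thesis using Iso_inv_cancel(2)[OF M, of "smul (inverse (\<epsilon> n)) (e n)"] by simp
qed

lemma reflection_monomial:
  assumes \<epsilon>: "unimodular \<epsilon>" and \<pi>: "bij \<pi>" and r: "isometric_reflection v f"
  obtains w g where "isometric_reflection w g" "w = monomial \<epsilon> \<pi> v"
    "\<And>n. coord (\<pi> n) w = \<epsilon> n * coord n v" "\<And>n. g (e (\<pi> n)) = inverse (\<epsilon> n) * f (e n)"
proof
  show "isometric_reflection (monomial \<epsilon> \<pi> v) (\<lambda>x. f (inv (monomial \<epsilon> \<pi>) x))"
    by (rule reflection_conj[OF monomial_Iso[OF \<epsilon> \<pi>] r])
qed (simp_all add: coord_monomial[OF \<epsilon> \<pi>] inv_monomial_e[OF \<epsilon> \<pi>] reflection_smul[OF r])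

lemma reflection_expansion:
  assumes "isometric_reflection v f"
  shows "(\<lambda>N. \<Sum>k<N. coord k x * f (e k)) \<longlonglongrightarrow> f x"
  using reflection_fconv[OF assms coord_expansion[of x]]
  by (simp add: reflection_sum[OF assms] reflection_smul[OF assms])

text \<open>The scalar \<open>f (e j) v\<^sub>j\<close> is the squared cosine of the angle between \<open>v\<close> and \<open>e j\<close>.\<close>
lemma reflection_coord:
  assumes r: "isometric_reflection v f"
  shows "f (e j) * coord j v = of_real (norm (f (e j)) * norm (coord j v))"
    and "norm (f (e j)) * norm (coord j v) \<le> 1"
proof -
  obtain t where t: "0 \<le> t" "t \<le> 1" "f (e j) * coord j v = of_real t"
    using reflection_angle[OF field r coord_reflection[of j]] by blast
  then have "norm (f (e j)) * norm (coord j v) = t"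
    by (metis abs_of_nonneg norm_mult norm_of_real)
  with t show "f (e j) * coord j v = of_real (norm (f (e j)) * norm (coord j v))"
    and "norm (f (e j)) * norm (coord j v) \<le> 1" by simp_all
qed

text \<open>Let \<open>M\<close> rotate the coordinate planes \<open>(2 i, 2 i + 1)\<close> by a quarter turn, in directions to be
  chosen. Since \<open>M\<^sup>-\<^sup>1 = - M\<close>, the squared cosine of the angle between \<open>v\<close> and \<open>M v\<close> is
  \<open>- (f (M v))\<^sup>2\<close>. For real coordinates it is nonnegative only if \<open>f (M v) = 0\<close>. With the
  right directions, \<open>f (M v)\<close> is the sum of the absolute values of the minors
  \<open>b (2 i) a (2 i + 1) - b (2 i + 1) a (2 i)\<close>; so they all vanish.\<close>
lemma reflection_minor_zero:
  assumes r: "isometric_reflection v f"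
    and a: "\<And>n. f (e n) = of_real (a n)" and b: "\<And>n. coord n v = of_real (b n)"
  shows "a 0 * b 1 = a 1 * b 0"
proof -
  \<comment> \<open>the minors, the directions of the quarter turns, and the data of the monomial operator \<open>M\<close>\<close>
  define D where "D i = b (2 * i) * a (2 * i + 1) - b (2 * i + 1) * a (2 * i)" for i
  define \<sigma> :: "nat \<Rightarrow> real" where "\<sigma> i = (if D i \<ge> 0 then 1 else -1)" for i
  define \<pi> :: "nat \<Rightarrow> nat" where "\<pi> n = (if even n then n + 1 else n - 1)" for n
  define \<epsilon> :: "nat \<Rightarrow> 'k" where "\<epsilon> n = of_real (if even n then \<sigma> (n div 2) else - \<sigma> (n div 2))" for n
  have \<pi>\<pi>: "\<pi> (\<pi> n) = n" for n by (auto simp: \<pi>_def)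
  then have \<pi>: "bij \<pi>" by (rule involuntory_imp_bij)
  have \<epsilon>: "unimodular \<epsilon>" by (simp add: unimodular_def \<epsilon>_def \<sigma>_def)
  have "\<pi> n div 2 = n div 2" "even (\<pi> n) \<longleftrightarrow> odd n" for n
    by (auto simp: \<pi>_def elim!: oddE evenE)
  then have \<epsilon>\<epsilon>: "\<epsilon> (\<pi> n) * \<epsilon> n = -1" for n
    by (simp add: \<epsilon>_def \<sigma>_def)
  let ?M = "monomial \<epsilon> \<pi>"
  note M = monomial_Iso[OF \<epsilon> \<pi>]
  note cM = coord_monomial[OF \<epsilon> \<pi>]
  have MM: "?M (?M x) = - x" for x
  proof (rule coord_eqI)
    fix n
    have "coord n (?M (?M x)) = \<epsilon> (\<pi> n) * \<epsilon> n * coord n x"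
      using cM[where n = "\<pi> n" and x = "?M x"] cM[where n = n and x = x] by (simp add: \<pi>\<pi>)
    then show "coord n (?M (?M x)) = coord n (- x)" by (simp add: \<epsilon>\<epsilon>)
  qed
  have invM: "inv ?M v = - ?M v"
    using Iso_inv_cancel(2)[OF M, of "- ?M v"] by (simp add: Iso_minus[OF M] MM)
  obtain t where t: "0 \<le> t" "f (?M v) * f (inv ?M v) = of_real t"
    using reflection_angle[OF field r reflection_conj[OF M r]] by blast
  define L where "L = f (?M v)"
  have L: "L\<^sup>2 + of_real t = 0"
    using t(2) by (simp add: L_def invM reflection_minus[OF r] power2_eq_square flip: t(2))
  define s where "s m = (\<Sum>i<m. \<bar>D i\<bar>)" for m
  have "(\<Sum>k<2 * m. coord k (?M v) * f (e k)) = of_real (s m)" for m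
  proof (induction m)
    case (Suc m)
    have c0: "coord (2 * m) (?M v) = of_real (- \<sigma> m * b (2 * m + 1))"
      using cM[where n = "2 * m + 1" and x = v] by (simp add: \<pi>_def \<epsilon>_def b)
    have c1: "coord (2 * m + 1) (?M v) = of_real (\<sigma> m * b (2 * m))"
      using cM[where n = "2 * m" and x = v] by (simp add: \<pi>_def \<epsilon>_def b)
    have "(\<Sum>k<2 * Suc m. coord k (?M v) * f (e k)) = (\<Sum>k<2 * m. coord k (?M v) * f (e k)) +
        coord (2 * m) (?M v) * f (e (2 * m)) + coord (2 * m + 1) (?M v) * f (e (2 * m + 1))"
      by simp
    also have "\<dots> = of_real (s m + (- \<sigma> m * b (2 * m + 1) * a (2 * m) + \<sigma> m * b (2 * m) * a (2 * m + 1)))"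
      unfolding Suc c0 c1 unfolding a by (simp only: of_real_add of_real_mult add.assoc)
    also have "- \<sigma> m * b (2 * m + 1) * a (2 * m) + \<sigma> m * b (2 * m) * a (2 * m + 1) = \<bar>D m\<bar>"
      by (auto simp: \<sigma>_def D_def algebra_simps)
    also have "s m + \<bar>D m\<bar> = s (Suc m)" by (simp add: s_def)
    finally show ?case .
  qed (simp add: s_def)
  moreover have "(\<lambda>m. \<Sum>k<2 * m. coord k (?M v) * f (e k)) \<longlonglongrightarrow> L"
    using LIMSEQ_subseq_LIMSEQ[OF reflection_expansion[OF r, of "?M v"], of "\<lambda>m. 2 * m"]
    by (simp add: strict_mono_def comp_def L_def)
  ultimately have "(\<lambda>m. of_real (s m) :: 'k) \<longlonglongrightarrow> L" by simp
  then have "(\<lambda>m. (of_real (s m))\<^sup>2 + of_real t :: 'k) \<longlonglongrightarrow> L\<^sup>2 + of_real t"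
    by (intro tendsto_intros)
  then have "(\<lambda>m. of_real ((s m)\<^sup>2 + t) :: 'k) \<longlonglongrightarrow> of_real 0"
    by (simp add: L)
  then have "(\<lambda>m. (s m)\<^sup>2 + t) \<longlonglongrightarrow> 0"
    by (simp only: tendsto_of_real_iff)
  moreover have "\<bar>D 0\<bar>\<^sup>2 \<le> (s m)\<^sup>2 + t" if "m \<ge> 1" for m
  proof -
    have "\<bar>D 0\<bar> \<le> s m"
      unfolding s_def using that by (intro member_le_sum) auto
    then have "\<bar>D 0\<bar>\<^sup>2 \<le> (s m)\<^sup>2" by (intro power_mono) auto
    with t(1) show ?thesis by linarith
  qed
  ultimately have "\<bar>D 0\<bar>\<^sup>2 \<le> 0"
    by (intro LIMSEQ_le_const[of _ 0]) blast+
  then show ?thesis by (simp add: D_def mult.commute)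
qed

lemma ex_bij_two_points:
  assumes "j \<noteq> (k :: nat)"
  obtains \<pi> :: "nat \<Rightarrow> nat" where "bij \<pi>" "\<pi> j = 0" "\<pi> k = 1"
proof
  let ?k = "Transposition.transpose 0 j k"
  let ?\<pi> = "Transposition.transpose ?k 1 \<circ> Transposition.transpose 0 j"
  show "bij ?\<pi>" by (intro bij_comp) auto
  show "?\<pi> j = 0" "?\<pi> k = 1"
    using assms by (auto simp: Transposition.transpose_def)
qed

text \<open>In modulus, the functional of an isometric reflection is a multiple of the inner product with its
  vector. A change of phases makes all coordinates of \<open>v\<close> and \<open>f\<close> nonnegative; where \<open>v\<^sub>n \<noteq> 0\<close>,
  the phase that makes \<open>v\<^sub>n\<close> positive also works for \<open>f (e n)\<close>, because \<open>f (e n) v\<^sub>n\<close> is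
  nonnegative.\<close>
lemma reflection_proportional:
  assumes r: "isometric_reflection v f"
  shows "norm (f (e j)) * norm (coord k v) = norm (f (e k)) * norm (coord j v)"
proof (cases "j = k")
  case False
  then obtain \<pi> :: "nat \<Rightarrow> nat" where \<pi>: "bij \<pi>" "\<pi> j = 0" "\<pi> k = 1"
    by (rule ex_bij_two_points)
  define \<epsilon> :: "nat \<Rightarrow> 'k" where "\<epsilon> n = (if coord n v \<noteq> 0 then of_real (norm (coord n v)) / coord n v
      else if f (e n) \<noteq> 0 then f (e n) / of_real (norm (f (e n))) else 1)" for n
  have \<epsilon>: "unimodular \<epsilon>" by (simp add: unimodular_def \<epsilon>_def norm_divide)
  obtain w g where wg: "isometric_reflection w g"
    "\<And>n. coord (\<pi> n) w = \<epsilon> n * coord n v" "\<And>n. g (e (\<pi> n)) = inverse (\<epsilon> n) * f (e n)"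
    using reflection_monomial[of \<epsilon> \<pi> v f, OF \<epsilon> \<pi>(1) r] by metis
  have b: "\<epsilon> n * coord n v = of_real (norm (coord n v))" for n
    by (simp add: \<epsilon>_def)
  have a: "inverse (\<epsilon> n) * f (e n) = of_real (norm (f (e n)))" for n
    using reflection_coord(1)[OF r, of n] by (simp add: \<epsilon>_def field_simps)
  have inv: "\<pi> (inv \<pi> n) = n" for n using \<pi>(1) by (simp add: bij_is_surj surj_f_inv_f)
  have inv01: "inv \<pi> 0 = j" "inv \<pi> 1 = k"
    using \<pi> by (metis bij_inv_eq_iff)+
  have "norm (f (e (inv \<pi> 0))) * norm (coord (inv \<pi> 1) v) =
      norm (f (e (inv \<pi> 1))) * norm (coord (inv \<pi> 0) v)"
  proof (rule reflection_minor_zero[OF wg(1)])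
    show "g (e n) = of_real (norm (f (e (inv \<pi> n))))" for n
      using wg(3)[of "inv \<pi> n"] by (simp only: inv a)
    show "coord n w = of_real (norm (coord (inv \<pi> n) v))" for n
      using wg(2)[of "inv \<pi> n"] by (simp only: inv b)
  qed
  then show ?thesis unfolding inv01 .
qed simp

text \<open>This is the expansion of \<open>f v = 1\<close>, whose terms are nonnegative reals.\<close>
lemma reflection_norm_sum:
  assumes "isometric_reflection v f"
  shows "(\<lambda>N. \<Sum>k<N. norm (f (e k)) * norm (coord k v)) \<longlonglongrightarrow> 1"
proof -
  have "(\<lambda>N. of_real (\<Sum>k<N. norm (f (e k)) * norm (coord k v)) :: 'k) \<longlonglongrightarrow> of_real 1"
    using reflection_expansion[OF assms, of v]
    by (simp add: reflection_self[OF assms] reflection_coord(1)[OF assms] mult.commute[of "coord _ v"]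
             flip: of_real_mult)
  then show ?thesis by (simp only: tendsto_of_real_iff)
qed

lemma reflection_coord_nonzero:
  assumes "isometric_reflection v f"
  obtains k where "coord k v \<noteq> 0" "f (e k) \<noteq> 0"
proof -
  have "v \<noteq> 0" by (rule reflection_nonzero[OF assms])
  have "\<exists>k. coord k v \<noteq> 0 \<and> f (e k) \<noteq> 0"
  proof (rule ccontr)
    assume "\<nexists>k. coord k v \<noteq> 0 \<and> f (e k) \<noteq> 0"
    then have "(\<Sum>k<N. norm (f (e k)) * norm (coord k v)) = 0" for N
      by (intro sum.neutral) auto
    then show False using reflection_norm_sum[OF assms] by (simp add: LIMSEQ_const_iff)
  qed
  with that show ?thesis by blast
qed

lemma reflection_zero_iff:
  assumes "isometric_reflection v f"
  shows "f (e k) = 0 \<longleftrightarrow> coord k v = 0"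
proof -
  obtain j where j: "coord j v \<noteq> 0" "f (e j) \<noteq> 0" by (rule reflection_coord_nonzero[OF assms])
  with reflection_proportional[OF assms, of k j] show ?thesis by auto
qed

lemma reflection_functional_tendsto_zero:
  assumes "isometric_reflection v f"
  shows "(\<lambda>k. f (e k)) \<longlonglongrightarrow> 0"
proof -
  obtain j where j: "coord j v \<noteq> 0" by (rule reflection_coord_nonzero[OF assms])
  have "(\<lambda>k. norm (f (e j)) / norm (coord j v) * norm (coord k v)) \<longlonglongrightarrow> 0"
    using coord_tendsto_zero[of v] by (intro tendsto_mult_right_zero tendsto_norm_zero)
  moreover have "norm (f (e j)) / norm (coord j v) * norm (coord k v) = norm (f (e k))" for k
    using reflection_proportional[OF assms, of j k] j by (simp add: field_simps)
  ultimately show ?thesis by (simp add: tendsto_norm_zero_iff)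
qed

end

section \<open>Reflections with small angles\<close>

context symmetric_basis_space
begin

lemma reflection_permute:
  assumes "isometric_reflection v f"
  obtains w g where "isometric_reflection w g" "\<And>a. fnorm (smul a w) = fnorm (smul a v)"
    "\<And>n. coord (Transposition.transpose j k n) w = coord n v"
    "\<And>n. g (e (Transposition.transpose j k n)) = f (e n)"
proof -
  have \<epsilon>: "unimodular (\<lambda>_. 1)" and \<pi>: "bij (Transposition.transpose j k)"
    by (simp_all add: unimodular_def)
  obtain w g where wg: "isometric_reflection w g" "w = monomial (\<lambda>_. 1) (Transposition.transpose j k) v"
    "\<And>n. coord (Transposition.transpose j k n) w = 1 * coord n v"
    "\<And>n. g (e (Transposition.transpose j k n)) = inverse 1 * f (e n)"
    using reflection_monomial[OF \<epsilon> \<pi> assms] by metis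
  have "fnorm (smul a w) = fnorm (smul a v)" for a
    using monomial_Iso[OF \<epsilon> \<pi>] fnorm_monomial[OF \<epsilon> \<pi>, of "smul a v"]
    by (simp add: wg(2) Iso_smul)
  with wg that show ?thesis by simp
qed

lemma reflection_partial_sum_le:
  assumes "isometric_reflection v f" "finite A"
  shows "(\<Sum>k\<in>A. norm (f (e k)) * norm (coord k v)) \<le> 1"
proof -
  obtain N where N: "A \<subseteq> {..<N}" using assms(2) finite_nat_iff_bounded by blast
  have "incseq (\<lambda>N. \<Sum>k<N. norm (f (e k)) * norm (coord k v))"
    by (intro incseq_SucI) simp
  then have "(\<Sum>k<N. norm (f (e k)) * norm (coord k v)) \<le> 1"
    by (rule incseq_le) (rule reflection_norm_sum[OF assms(1)])
  moreover have "(\<Sum>k\<in>A. norm (f (e k)) * norm (coord k v)) \<le> (\<Sum>k<N. norm (f (e k)) * norm (coord k v))"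
    using N by (intro sum_mono2) auto
  ultimately show ?thesis by linarith
qed

lemma reflection_norm_sum_single:
  assumes r: "isometric_reflection v f" and v: "\<And>k. k \<noteq> j \<Longrightarrow> coord k v = 0"
  shows "norm (f (e j)) * norm (coord j v) = 1"
proof -
  have "(\<Sum>k<N. norm (f (e k)) * norm (coord k v)) = norm (f (e j)) * norm (coord j v)" if "j < N" for N
  proof -
    have "(\<Sum>k<N. norm (f (e k)) * norm (coord k v)) = (\<Sum>k<N. if k = j then norm (f (e j)) * norm (coord j v) else 0)"
      using v by (intro sum.cong) auto
    with that show ?thesis by simp
  qed
  then have "(\<lambda>N. \<Sum>k<N. norm (f (e k)) * norm (coord k v)) \<longlonglongrightarrow> norm (f (e j)) * norm (coord j v)"
    by (intro tendsto_eventually eventually_sequentiallyI[of "Suc j"]) simp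
  with reflection_norm_sum[OF r] show ?thesis by (metis LIMSEQ_unique)
qed

text \<open>An F-norm may be constant on parts of a ray, so that \<open>fnorm (a x) = fnorm x\<close> alone does not give
  \<open>\<bar>a\<bar> = 1\<close>. Invariance under all \<open>t x\<close> allows one to iterate, and \<open>a\<^sup>m x\<close> would tend to zero
  if \<open>\<bar>a\<bar> < 1\<close>.\<close>
lemma norm_eq_1_if_fnorm_smul_invariant:
  assumes inv: "\<And>t. fnorm (smul (t * a) x) = fnorm (smul t x)" and x: "x \<noteq> 0"
  shows "norm a = 1"
proof -
  have False if inv: "\<And>t. fnorm (smul (t * b) x) = fnorm (smul t x)" and b: "norm b < 1" for b
  proof -
    have "fnorm (smul (b ^ m) x) = fnorm x" for m
    proof (induction m)
      case (Suc m)
      then show ?case using inv[of "b ^ m"] by (simp add: mult.commute)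
    qed simp
    moreover have "(\<lambda>m. b ^ m) \<longlonglongrightarrow> 0" using b by (rule LIMSEQ_power_zero)
    then have "(\<lambda>m. fnorm (smul (b ^ m) x)) \<longlonglongrightarrow> 0"
      using smul_tendsto_zero_iff[OF x, of "\<lambda>m. b ^ m"] by blast
    ultimately show False using fnorm_pos[OF x] by (simp add: LIMSEQ_const_iff)
  qed
  note small = this
  have "norm a \<ge> 1" using small[OF inv] by force
  then have "a \<noteq> 0" by auto
  have "fnorm (smul (t * inverse a) x) = fnorm (smul t x)" for t
    using inv[of "t * inverse a"] \<open>a \<noteq> 0\<close> by (simp add: mult.assoc)
  then have "\<not> norm (inverse a) < 1" using small by blast
  then have "norm a \<le> 1"
    by (simp add: norm_inverse inverse_less_1_iff)
  with \<open>norm a \<ge> 1\<close> show ?thesis by simp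
qed

text \<open>Exchanging two coordinates and changing both signs.\<close>
lemma reflection_e_add_e:
  assumes "k \<noteq> n"
  shows "isometric_reflection (e n + e k) (\<lambda>x. (coord n x + coord k x) / 2)"
proof -
  define \<epsilon> :: "nat \<Rightarrow> 'k" where "\<epsilon> i = (if i \<in> {n, k} then -1 else 1)" for i
  have \<epsilon>: "unimodular \<epsilon>" by (simp add: unimodular_def \<epsilon>_def)
  have \<pi>: "bij (Transposition.transpose n k)" by simp
  have "monomial \<epsilon> (Transposition.transpose n k) x = x - smul (coord n x + coord k x) (e n + e k)" for x
    by (rule coord_eqI_bij[OF \<epsilon> \<pi>], unfold coord_monomial[OF \<epsilon> \<pi>])
      (use assms in \<open>auto simp: \<epsilon>_def coord_e Transposition.transpose_def\<close>)
  then have "fnorm (x - smul (coord n x + coord k x) (e n + e k)) = fnorm x" for x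
    using fnorm_monomial[OF \<epsilon> \<pi>, of x] by simp
  then show ?thesis
    using assms by (simp add: isometric_reflection_def coord_e add_divide_distrib distrib_left)
qed

text \<open>As \<open>T (e n)\<close> is not a unimodular multiple of a basis vector, it has a coordinate of weight strictly
  between 0 and 1. If that weight is 1/2, one passes to the reflection of \<open>T (e n + e k)\<close>,
  whose weight at the same place tends to 1/4 for \<open>k\<close> tending to infinity. The weight 1/2 has to be avoided
  because it makes \<open>1 - 2 f (e 0) v\<^sub>0\<close>, on which \<open>reflection_chain\<close> builds, vanish.\<close>
lemma ex_reflection_generic_weight:
  assumes T: "T \<in> Iso smul fnorm" and not_mon: "\<And>a k. norm a = 1 \<Longrightarrow> T (e n) \<noteq> smul a (e k)"
  obtains v f where "isometric_reflection v f" "f (e 0) \<noteq> 0"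
    "norm (f (e 0)) * norm (coord 0 v) < 1" "norm (f (e 0)) * norm (coord 0 v) \<noteq> 1 / 2"
proof -
  define v where "v = T (e n)"
  define f where "f x = coord n (inv T x)" for x
  have r: "isometric_reflection v f"
    unfolding v_def f_def by (rule reflection_conj[OF T coord_reflection])
  have pj: "\<exists>j. f (e j) \<noteq> 0 \<and> norm (f (e j)) * norm (coord j v) < 1"
  proof (rule ccontr)
    assume neg: "\<nexists>j. f (e j) \<noteq> 0 \<and> norm (f (e j)) * norm (coord j v) < 1"
    obtain j where j: "coord j v \<noteq> 0" "f (e j) \<noteq> 0" by (rule reflection_coord_nonzero[OF r])
    have v0: "coord k v = 0" if "k \<noteq> j" for k
    proof (rule ccontr)
      assume "coord k v \<noteq> 0"
      then have "norm (f (e k)) * norm (coord k v) \<ge> 1" "norm (f (e j)) * norm (coord j v) \<ge> 1"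
        using neg j reflection_zero_iff[OF r, of k] by force+
      then show False using that reflection_partial_sum_le[OF r, of "{j, k}"] by simp
    qed
    define a where "a = coord j v"
    have Te: "T (e n) = smul a (e j)"
      by (rule coord_eqI) (use v0 in \<open>auto simp: v_def[symmetric] a_def coord_e\<close>)
    have "fnorm (smul (t * a) (e 0)) = fnorm (smul t (e 0))" for t
    proof -
      have "fnorm (smul (t * a) (e 0)) = fnorm (T (smul t (e n)))"
        by (simp add: Iso_smul[OF T] Te fnorm_smul_e[of _ j])
      then show ?thesis by (simp add: Iso_fnorm[OF T] fnorm_smul_e[of _ n])
    qed
    then have "norm a = 1" by (rule norm_eq_1_if_fnorm_smul_invariant) simp
    with not_mon Te show False by blast
  qed
  then obtain j where j: "f (e j) \<noteq> 0" "norm (f (e j)) * norm (coord j v) < 1" by blast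
  have "\<exists>w g. isometric_reflection w g \<and> g (e j) \<noteq> 0 \<and> norm (g (e j)) * norm (coord j w) < 1 \<and>
      norm (g (e j)) * norm (coord j w) \<noteq> 1 / 2"
  proof (cases "norm (f (e j)) * norm (coord j v) = 1 / 2")
    case True
    define g where "g k x = (coord n (inv T x) + coord k (inv T x)) / 2" for k x
    define q where "q k = norm (g k (e j)) * norm (coord j (T (e n + e k)))" for k
    have "isometric_reflection (inv T (e j)) (\<lambda>x. coord j (inv (inv T) x))"
      by (rule reflection_conj[OF Iso_inv[OF T] coord_reflection])
    \<comment> \<open>this reflection has the functional \<open>x \<mapsto> coord j (T x)\<close>\<close>
    from reflection_functional_tendsto_zero[OF this]
    have \<beta>: "(\<lambda>k. coord j (T (e k))) \<longlonglongrightarrow> 0"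
      by (simp add: inv_inv_eq[OF Iso_bij[OF T]])
    have "q \<longlonglongrightarrow> norm ((f (e j) + 0) / 2) * norm (coord j v + 0)"
      unfolding q_def g_def f_def v_def Iso_add[OF T] coord_add
      by (intro tendsto_intros \<beta> coord_tendsto_zero) simp
    then have "q \<longlonglongrightarrow> 1 / 4"
      using True by (simp add: norm_divide)
    then have "eventually (\<lambda>k. q k > 0) sequentially" "eventually (\<lambda>k. q k < 1 / 2) sequentially"
      by (rule order_tendstoD, simp)+
    then have "eventually (\<lambda>k. q k > 0 \<and> q k < 1 / 2 \<and> k > n) sequentially"
      by (intro eventually_conj eventually_gt_at_top)
    then obtain k where k: "q k > 0" "q k < 1 / 2" "k \<noteq> n"
      by (auto simp: eventually_sequentially)
    have "isometric_reflection (T (e n + e k)) (g k)"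
      unfolding g_def using reflection_conj[OF T reflection_e_add_e[OF k(3)]] .
    moreover have "g k (e j) \<noteq> 0" using k(1) by (auto simp: q_def)
    ultimately show ?thesis using k unfolding q_def by fastforce
  qed (use r j in blast)
  then obtain w g where wg: "isometric_reflection w g" "g (e j) \<noteq> 0"
    "norm (g (e j)) * norm (coord j w) < 1" "norm (g (e j)) * norm (coord j w) \<noteq> 1 / 2"
    by blast
  obtain w' g' where w': "isometric_reflection w' g'"
    "\<And>n. coord (Transposition.transpose 0 j n) w' = coord n w"
    "\<And>n. g' (e (Transposition.transpose 0 j n)) = g (e n)"
    using reflection_permute[OF wg(1)] by metis
  show ?thesis
    using that[OF w'(1)] w'(2,3)[of j] wg by simp
qed

text \<open>Let \<open>c = 1 - 2 f (e 0) v\<^sub>0\<close>. Reflecting a vector \<open>u\<close> in a copy of \<open>v\<close> whose support meets that of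
  \<open>u\<close> only in 0 multiplies the coordinate 0 of \<open>u\<close> by \<open>c\<close>. Since there is always room for another
  copy of \<open>v\<close>, the orbit of \<open>e 0\<close> contains vectors with coordinate 0 equal to any positive power of \<open>c\<close>.\<close>
lemma reflection_chain:
  assumes r: "isometric_reflection v f" and fin: "finite {k. coord k v \<noteq> 0}"
    and nz: "f (e 0) \<noteq> 0" and less: "norm (f (e 0)) * norm (coord 0 v) < 1"
  shows "\<exists>u h. isometric_reflection u h \<and> (\<forall>a. fnorm (smul a u) = fnorm (smul a (e 0))) \<and>
     finite {k. coord k u \<noteq> 0} \<and> coord 0 u = (1 - 2 * f (e 0) * coord 0 v) ^ Suc n \<and>
     h (e 0) = (1 - 2 * f (e 0) * coord 0 v) ^ Suc n \<and> (\<exists>k. k \<noteq> 0 \<and> coord k u \<noteq> 0)"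
proof (induction n)
  case 0
  let ?u = "reflect v f (e 0)" and ?h = "\<lambda>x. coord 0 (reflect v f x)"
  note R = reflect_Iso[OF r]
  have "isometric_reflection ?u ?h"
    using reflection_conj[OF R coord_reflection[of 0]] by (simp add: inv_reflect[OF r])
  moreover have "fnorm (smul a ?u) = fnorm (smul a (e 0))" for a
    using Iso_fnorm[OF R, of "smul a (e 0)"] by (simp add: Iso_smul[OF R])
  moreover have "{k. coord k ?u \<noteq> 0} \<subseteq> insert 0 {k. coord k v \<noteq> 0}"
    by (auto simp: reflect_def coord_e)
  then have "finite {k. coord k ?u \<noteq> 0}"
    using fin by (simp add: finite_subset)
  moreover have "\<exists>k. k \<noteq> 0 \<and> coord k ?u \<noteq> 0"
  proof -
    obtain k where "k \<noteq> 0" "coord k v \<noteq> 0"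
      using reflection_norm_sum_single[OF r, of 0] less by (metis less_irrefl)
    then show ?thesis using nz by (intro exI[of _ k]) (simp add: reflect_def coord_e)
  qed
  ultimately show ?case by (intro exI[of _ ?u] exI[of _ ?h]) (simp add: reflect_def)
next
  case (Suc n)
  define c where "c = 1 - 2 * f (e 0) * coord 0 v"
  obtain u h k where u: "isometric_reflection u h" "\<And>a. fnorm (smul a u) = fnorm (smul a (e 0))"
    "finite {k. coord k u \<noteq> 0}" "coord 0 u = c ^ Suc n" "h (e 0) = c ^ Suc n" "k \<noteq> 0" "coord k u \<noteq> 0"
    using Suc unfolding c_def by blast
  obtain N where "{k. coord k v \<noteq> 0} \<union> {k. coord k u \<noteq> 0} \<subseteq> {..<N}"
    using fin u(3) finite_nat_iff_bounded by (metis finite_Un)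
  then have N: "coord i v = 0" "coord i u = 0" if "i \<ge> N" for i
    using that by auto
  \<comment> \<open>\<open>\<pi>\<close> fixes 0 and exchanges the other indices below \<open>N\<close> with a block above \<open>N\<close>\<close>
  define \<pi> where "\<pi> i = (if 0 < i \<and> i < N then i + N else if N < i \<and> i < 2 * N then i - N else i)" for i
  have \<pi>\<pi>: "\<pi> (\<pi> i) = i" for i by (auto simp: \<pi>_def)
  then have \<pi>: "bij \<pi>" by (rule involuntory_imp_bij)
  have \<epsilon>: "unimodular (\<lambda>_. 1)" by (simp add: unimodular_def)
  obtain w g where wg: "isometric_reflection w g" "\<And>n. coord (\<pi> n) w = 1 * coord n v"
    "\<And>n. g (e (\<pi> n)) = inverse 1 * f (e n)"
    using reflection_monomial[OF \<epsilon> \<pi> r] by metis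
  have w: "coord i w = coord (\<pi> i) v" and g: "g (e i) = f (e (\<pi> i))" for i
    using wg(2,3)[of "\<pi> i"] by (simp_all add: \<pi>\<pi>)
  have \<pi>0: "\<pi> 0 = 0" by (simp add: \<pi>_def)
  have w0: "coord i w = 0" if "0 < i" "i < N" for i
    using that by (simp add: w N \<pi>_def)
  have w_fin: "coord i w = 0" if "2 * N \<le> i" for i
    using that by (simp add: w N \<pi>_def)
  have disjoint: "coord i u = 0 \<or> coord i w = 0" if "i \<noteq> 0" for i
    using that w0[of i] N(2)[of i] by force
  \<comment> \<open>the inner product of vectors whose supports meet at most in 0\<close>
  have pairing: "s x = coord 0 x * s (e 0)"
    if s: "isometric_reflection y s" and xy: "\<And>i. i \<noteq> 0 \<Longrightarrow> coord i x = 0 \<or> coord i y = 0" for x y s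
  proof -
    have "(\<Sum>k<m. coord k x * s (e k)) = coord 0 x * s (e 0)" if "m > 0" for m
    proof -
      have "(\<Sum>k<m. coord k x * s (e k)) = (\<Sum>k<m. if k = 0 then coord 0 x * s (e 0) else 0)"
        using xy reflection_zero_iff[OF s] by (intro sum.cong) auto
      with that show ?thesis by simp
    qed
    then have "(\<lambda>m. \<Sum>k<m. coord k x * s (e k)) \<longlonglongrightarrow> coord 0 x * s (e 0)"
      by (intro tendsto_eventually eventually_sequentiallyI[of 1]) simp
    with reflection_expansion[OF s, of x] show ?thesis by (metis LIMSEQ_unique)
  qed
  have gu: "g u = coord 0 u * f (e 0)"
    using pairing[OF wg(1), of u] disjoint by (simp add: g \<pi>0)
  have hw: "h w = coord 0 v * h (e 0)"
    using pairing[OF u(1), of w] disjoint by (auto simp: w \<pi>0)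
  let ?u = "reflect w g u" and ?h = "\<lambda>x. h (reflect w g x)"
  note R = reflect_Iso[OF wg(1)]
  have "isometric_reflection ?u ?h"
    using reflection_conj[OF R u(1)] by (simp add: inv_reflect[OF wg(1)])
  moreover have "fnorm (smul a ?u) = fnorm (smul a (e 0))" for a
    using Iso_fnorm[OF R, of "smul a u"] by (simp add: Iso_smul[OF R] u(2))
  moreover have "finite {k. coord k ?u \<noteq> 0}"
  proof (rule finite_subset)
    show "{k. coord k ?u \<noteq> 0} \<subseteq> {..<2 * N}"
    proof
      fix i assume "i \<in> {k. coord k ?u \<noteq> 0}"
      then have "coord i u \<noteq> 0 \<or> coord i w \<noteq> 0" by (auto simp: reflect_def)
      then show "i \<in> {..<2 * N}" using N(2)[of i] w_fin[of i] by force
    qed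
  qed simp
  moreover have "coord 0 ?u = c ^ Suc (Suc n)"
    by (simp add: reflect_def gu w \<pi>0 u(4) c_def algebra_simps)
  moreover have "?h (e 0) = c ^ Suc (Suc n)"
    by (simp add: reflect_def reflection_diff[OF u(1)] reflection_smul[OF u(1)] hw g \<pi>0 u(5) c_def algebra_simps)
  moreover have "coord k ?u \<noteq> 0"
    using u(6,7) w0[of k] N(2)[of k] by (force simp: reflect_def)
  ultimately show ?case
    unfolding c_def using u(6) by (intro exI[of _ ?u] exI[of _ ?h] conjI) blast+
qed

text \<open>If \<open>v\<close> has finite support, the vectors of \<open>reflection_chain\<close> have small coordinates 0; they stay
  bounded because they lie in the orbit of \<open>e 0\<close>. If \<open>v\<close> has infinite support, its own coordinates get
  arbitrarily small, and one of them can be moved to the place 0.\<close>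
lemma ex_small_reflection:
  assumes r: "isometric_reflection v f" and nz: "f (e 0) \<noteq> 0"
    and less: "norm (f (e 0)) * norm (coord 0 v) < 1"
    and half: "norm (f (e 0)) * norm (coord 0 v) \<noteq> 1 / 2" and \<delta>: "\<delta> > 0"
  obtains w g k where "isometric_reflection w g" "g (e 0) \<noteq> 0" "k \<noteq> 0" "coord k w \<noteq> 0"
    "fnorm (smul (2 * g (e 0)) w) < \<delta>"
proof (cases "finite {k. coord k v \<noteq> 0}")
  case True
  define p where "p = norm (f (e 0)) * norm (coord 0 v)"
  define c where "c = 1 - 2 * p"
  have "coord 0 v \<noteq> 0" using nz reflection_zero_iff[OF r] by blast
  then have p: "0 < p" "p < 1" "p \<noteq> 1 / 2" using nz less half by (auto simp: p_def)
  have "1 - 2 * f (e 0) * coord 0 v = 1 - 2 * of_real p"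
    using reflection_coord(1)[OF r, of 0] by (simp add: p_def mult.assoc)
  then have c: "1 - 2 * f (e 0) * coord 0 v = of_real c" by (simp add: c_def)
  have "\<bar>c\<bar> < 1" using p by (simp add: c_def abs_less_iff)
  then have "norm (of_real c :: 'k) < 1" by simp
  then have "(\<lambda>n. of_real c ^ Suc n :: 'k) \<longlonglongrightarrow> 0"
    by (intro LIMSEQ_Suc LIMSEQ_power_zero)
  then have "(\<lambda>n. 2 * of_real c ^ Suc n :: 'k) \<longlonglongrightarrow> 0"
    by (rule tendsto_mult_right_zero)
  then have "(\<lambda>n. fnorm (smul (2 * of_real c ^ Suc n) (e 0))) \<longlonglongrightarrow> 0"
    by (simp only: smul_tendsto_zero_iff[OF e_nonzero])
  then have "eventually (\<lambda>n. fnorm (smul (2 * of_real c ^ Suc n) (e 0)) < \<delta>) sequentially"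
    using \<delta> by (rule order_tendstoD)
  then obtain n where n: "fnorm (smul (2 * of_real c ^ Suc n) (e 0)) < \<delta>"
    by (auto simp: eventually_sequentially)
  obtain u h k where "isometric_reflection u h" "\<And>a. fnorm (smul a u) = fnorm (smul a (e 0))"
     "h (e 0) = of_real c ^ Suc n" "k \<noteq> 0" "coord k u \<noteq> 0"
    using reflection_chain[OF r True nz less, of n] unfolding c by blast
  moreover have "c \<noteq> 0" using p by (simp add: c_def)
  ultimately show ?thesis using n by (intro that[of u h k]) auto
next
  case False
  have "(\<lambda>j. 2 * f (e j)) \<longlonglongrightarrow> 0"
    using reflection_functional_tendsto_zero[OF r] by (rule tendsto_mult_right_zero)
  then have "(\<lambda>j. fnorm (smul (2 * f (e j)) v)) \<longlonglongrightarrow> 0"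
    by (simp only: smul_tendsto_zero_iff[OF reflection_nonzero[OF r]])
  then have "eventually (\<lambda>j. fnorm (smul (2 * f (e j)) v) < \<delta>) sequentially"
    using \<delta> by (rule order_tendstoD)
  then obtain J where J: "\<And>j. j \<ge> J \<Longrightarrow> fnorm (smul (2 * f (e j)) v) < \<delta>"
    by (auto simp: eventually_sequentially)
  obtain j where j: "j \<ge> Suc J" "coord j v \<noteq> 0"
    using False unfolding infinite_nat_iff_unbounded_le by blast
  obtain w g where w: "isometric_reflection w g" "\<And>a. fnorm (smul a w) = fnorm (smul a v)"
    "\<And>n. coord (Transposition.transpose 0 j n) w = coord n v"
    "\<And>n. g (e (Transposition.transpose 0 j n)) = f (e n)"
    using reflection_permute[OF r] by metis
  have "coord 0 v \<noteq> 0" using nz reflection_zero_iff[OF r] by blast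
  then show ?thesis
    using w(3)[of 0] w(4)[of j] j J[of j] reflection_zero_iff[OF r, of j]
    by (intro that[OF w(1), of j]) (auto simp: w(2))
qed

end

section \<open>Rotations of coordinate planes\<close>

context F_normed_space
begin

text \<open>If \<open>\<zeta>, \<omega>\<close> are biorthogonal to \<open>z, w\<close>, this is the rotation by \<open>\<gamma>\<close> in the plane
  of \<open>z, w\<close>, extended by the identity on the common kernel of \<open>\<zeta>, \<omega>\<close>.\<close>
definition rotation :: "'a \<Rightarrow> ('a \<Rightarrow> 'k) \<Rightarrow> 'a \<Rightarrow> ('a \<Rightarrow> 'k) \<Rightarrow> real \<Rightarrow> 'a \<Rightarrow> 'a"
  where "rotation z \<zeta> w \<omega> \<gamma> x = x
    + smul (of_real (cos \<gamma> - 1) * \<zeta> x - of_real (sin \<gamma>) * \<omega> x) z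
    + smul (of_real (sin \<gamma>) * \<zeta> x + of_real (cos \<gamma> - 1) * \<omega> x) w"

lemma smul_combination_cong:
  "a = a' \<Longrightarrow> b = b' \<Longrightarrow> x + smul a z + smul b w = x + smul a' z + smul b' w"
  by simp

lemma rotation_rotation:
  assumes \<zeta>: "\<And>x y. \<zeta> (x + y) = \<zeta> x + \<zeta> y" "\<And>a x. \<zeta> (smul a x) = a * \<zeta> x"
    and \<omega>: "\<And>x y. \<omega> (x + y) = \<omega> x + \<omega> y" "\<And>a x. \<omega> (smul a x) = a * \<omega> x"
    and dual: "\<zeta> z = 1" "\<zeta> w = 0" "\<omega> z = 0" "\<omega> w = 1"
  shows "rotation z \<zeta> w \<omega> \<gamma> (rotation z \<zeta> w \<omega> \<delta> x) = rotation z \<zeta> w \<omega> (\<gamma> + \<delta>) x"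
proof -
  have combine: "x + smul a z + smul b w + smul c z + smul d w = x + smul (a + c) z + smul (b + d) w"
    for a b c d
    by (simp add: scale_left_distrib ac_simps)
  show ?thesis
    unfolding rotation_def[of z \<zeta> w \<omega> \<gamma> "rotation z \<zeta> w \<omega> \<delta> x"]
    unfolding rotation_def[of z \<zeta> w \<omega> \<delta>] rotation_def[of z \<zeta> w \<omega> "\<gamma> + \<delta>"] combine \<zeta> \<omega> dual
    by (rule smul_combination_cong)
       (simp_all add: cos_add sin_add algebra_simps)
qed

text \<open>The vectors \<open>u\<close> and \<open>u'\<close> have the angles \<open>\<beta>\<close> and \<open>-\<beta>\<close> to \<open>z\<close>, and the product of two
  reflections is a rotation by twice the angle between them.\<close>
lemma reflect_reflect_eq_rotation:
  assumes \<zeta>: "\<And>x y. \<zeta> (x + y) = \<zeta> x + \<zeta> y" "\<And>a x. \<zeta> (smul a x) = a * \<zeta> x"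
    and \<omega>: "\<And>x y. \<omega> (x + y) = \<omega> x + \<omega> y" "\<And>a x. \<omega> (smul a x) = a * \<omega> x"
    and dual: "\<zeta> z = 1" "\<zeta> w = 0" "\<omega> z = 0" "\<omega> w = 1"
    and c: "c = of_real (cos \<beta>)" and s: "s = of_real (sin \<beta>)"
    and u: "u = smul c z + smul s w" and h: "\<And>x. h x = c * \<zeta> x + s * \<omega> x"
    and u': "u' = smul c z - smul s w" and h': "\<And>x. h' x = c * \<zeta> x - s * \<omega> x"
  shows "reflect u h (reflect u' h' x) = rotation z \<zeta> w \<omega> (4 * \<beta>) x"
proof -
  have cs: "c * c + s * s = 1"
    unfolding c s by (metis of_real_1 of_real_add of_real_mult power2_eq_square sin_cos_squared_add2)
  have cos4: "cos (4 * \<beta>) - 1 = - 8 * (sin \<beta>)\<^sup>2 * (cos \<beta>)\<^sup>2"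
    using cos_double_sin[of "2 * \<beta>"] by (simp add: sin_double power_mult_distrib)
  have sin4: "sin (4 * \<beta>) = 4 * sin \<beta> * cos \<beta> * ((cos \<beta>)\<^sup>2 - (sin \<beta>)\<^sup>2)"
    using sin_double[of "2 * \<beta>"] by (simp add: sin_double cos_double)
  have C: "of_real (cos (4 * \<beta>) - 1) = - 8 * (s * s) * (c * c)"
    unfolding cos4 c s by (simp add: power2_eq_square)
  have S: "of_real (sin (4 * \<beta>)) = 4 * s * c * (c * c - s * s)"
    unfolding sin4 c s by (simp add: power2_eq_square)
  define q where "q = h' x"
  define r where "r = h (reflect u' h' x)"
  have neg: "\<zeta> (y - v) = \<zeta> y - \<zeta> v" "\<omega> (y - v) = \<omega> y - \<omega> v" for y v
    using \<zeta>(1)[of y "- v"] \<zeta>(2)[of "-1" v] \<omega>(1)[of y "- v"] \<omega>(2)[of "-1" v] by simp_all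
  have r: "r = h x - 2 * q * (c * c - s * s)"
    unfolding r_def by (simp add: reflect_def h u' neg \<zeta> \<omega> dual flip: q_def) (simp add: algebra_simps)
  have "reflect u h (reflect u' h' x) = x - smul (2 * q) u' - smul (2 * r) u"
    by (simp add: reflect_def q_def r_def)
  also have "\<dots> = x + smul (- 2 * q * c - 2 * r * c) z + smul (2 * q * s - 2 * r * s) w"
    unfolding u u' by (simp add: scale_right_distrib scale_right_diff_distrib scale_left_diff_distrib algebra_simps)
  also have "\<dots> = rotation z \<zeta> w \<omega> (4 * \<beta>) x"
    unfolding rotation_def
  proof (rule smul_combination_cong)
    show "- 2 * q * c - 2 * r * c = of_real (cos (4 * \<beta>) - 1) * \<zeta> x - of_real (sin (4 * \<beta>)) * \<omega> x"
      unfolding C S r q_def h h' using cs by algebra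
    show "2 * q * s - 2 * r * s = of_real (sin (4 * \<beta>)) * \<zeta> x + of_real (cos (4 * \<beta>) - 1) * \<omega> x"
      unfolding C S r q_def h h' using cs by algebra
  qed
  finally show ?thesis .
qed

end

context symmetric_basis_space
begin

text \<open>The reflection in \<open>w\<close> moves \<open>e 0\<close> by a vector of F-norm less than \<open>\<delta>\<close>, but not within its line.\<close>
definition small_reflections :: bool
  where "small_reflections \<longleftrightarrow> (\<forall>\<delta>>0. \<exists>w g k. isometric_reflection w g \<and> g (e 0) \<noteq> 0 \<and> k \<noteq> 0 \<and>
      coord k w \<noteq> 0 \<and> fnorm (smul (2 * g (e 0)) w) < \<delta>)"

lemma finite_expansion:
  assumes "finite {k. coord k x \<noteq> 0}"
  shows "\<exists>N. x = (\<Sum>k<N. smul (coord k x) (e k))"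
proof -
  obtain N where N: "{k. coord k x \<noteq> 0} \<subseteq> {..<N}"
    using assms finite_nat_iff_bounded by blast
  have "x = (\<Sum>k<N. smul (coord k x) (e k))"
  proof (rule coord_eqI)
    fix j
    have "(\<Sum>k<N. coord k x * coord j (e k)) = (\<Sum>k<N. if k = j then coord j x else 0)"
      by (intro sum.cong) (auto simp: coord_e)
    then show "coord j x = coord j (\<Sum>k<N. smul (coord k x) (e k))"
      using N by auto
  qed
  then show ?thesis ..
qed

text \<open>Let \<open>u\<close> be the image of \<open>e 0\<close> under a small reflection, with one nonzero coordinate moved to the
  place 1 and made positive. The functional of \<open>u\<close> has the same value at \<open>e 0\<close> as that of \<open>e 0\<close> has at
  \<open>u\<close>, so that the factor of proportionality between functional and vector is 1 in modulus.\<close>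
lemma ex_reflection_near_e0:
  assumes small: small_reflections
    and \<delta>: "\<delta> > 0"
  shows "\<exists>u h s. isometric_reflection u h \<and> 0 < s \<and> s < 1 \<and> fnorm (u - e 0) < \<delta> \<and>
    coord 1 u = of_real s \<and> h (e 1) = of_real s \<and> h (e 0) = coord 0 u \<and>
    (\<forall>k. norm (h (e k)) = norm (coord k u))"
proof -
  \<comment> \<open>the second bound keeps the coordinate 0 of \<open>u\<close> away from zero\<close>
  define \<delta>' where "\<delta>' = min \<delta> (fnorm (smul 2 (e 0)) / 2)"
  have "\<delta>' > 0" using \<delta> by (simp add: \<delta>'_def fnorm_pos)
  then obtain w g k where wg: "isometric_reflection w g" "g (e 0) \<noteq> 0" "k \<noteq> 0" "coord k w \<noteq> 0"
    "fnorm (smul (2 * g (e 0)) w) < \<delta>'"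
    using small unfolding small_reflections_def by blast
  define u0 where "u0 = reflect w g (e 0)"
  define h0 where "h0 x = coord 0 (reflect w g x)" for x
  have r0: "isometric_reflection u0 h0"
    unfolding u0_def h0_def using reflection_conj[OF reflect_Iso[OF wg(1)] coord_reflection[of 0]]
    by (simp add: inv_reflect[OF wg(1)])
  have u0k: "coord k u0 \<noteq> 0"
    using wg by (simp add: u0_def reflect_def coord_e)
  define \<epsilon> where "\<epsilon> i = (if i = k then of_real (norm (coord k u0)) / coord k u0 else 1)" for i
  have \<epsilon>: "unimodular \<epsilon>" using u0k by (simp add: unimodular_def \<epsilon>_def norm_divide)
  define \<pi> where "\<pi> = Transposition.transpose 1 k"
  have \<pi>: "bij \<pi>" "\<pi> k = 1" "\<pi> 0 = 0" using wg(3) by (auto simp: \<pi>_def Transposition.transpose_def)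
  obtain u h where uh: "isometric_reflection u h" "u = monomial \<epsilon> \<pi> u0"
    "\<And>n. coord (\<pi> n) u = \<epsilon> n * coord n u0" "\<And>n. h (e (\<pi> n)) = inverse (\<epsilon> n) * h0 (e n)"
    using reflection_monomial[OF \<epsilon> \<pi>(1) r0] by metis
  note M = monomial_Iso[OF \<epsilon> \<pi>(1)]
  have "monomial \<epsilon> \<pi> (e 0) = e 0"
    using wg(3) by (simp add: monomial_e[OF \<epsilon> \<pi>(1)] \<pi>(3) \<epsilon>_def)
  then have "fnorm (u - e 0) = fnorm (u0 - e 0)"
    using Iso_fnorm[OF M, of "u0 - e 0"] by (simp add: uh(2) Iso_diff[OF M])
  also have "\<dots> = fnorm (smul (2 * g (e 0)) w)"
    using fnorm_minus[of "smul (2 * g (e 0)) w"] by (simp add: u0_def reflect_def)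
  finally have near: "fnorm (u - e 0) < \<delta>'" using wg(5) by simp
  have "coord 0 u \<noteq> 0"
  proof
    assume "coord 0 u = 0"
    then have "fnorm (smul (2 * - 1) (e 0)) \<le> 2 * fnorm (u - e 0)"
      using fnorm_reflection_le[OF coord_reflection[of 0], of "u - e 0"] by simp
    moreover have "fnorm (smul (2 * - 1) (e 0)) = fnorm (smul 2 (e 0))"
      by (rule fnorm_smul_cong) simp
    ultimately show False using near by (simp add: \<delta>'_def)
  qed
  have h0: "h (e 0) = coord 0 u"
  proof -
    have "h0 (e 0) = coord 0 u0"
      by (simp add: h0_def u0_def reflect_def)
    then show ?thesis
      using uh(3,4)[of 0] \<pi>(3) wg(3) by (simp add: \<epsilon>_def)
  qed
  have same: "norm (h (e n)) = norm (coord n u)" for n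
    using reflection_proportional[OF uh(1), of 0 n] \<open>coord 0 u \<noteq> 0\<close> by (simp add: h0)
  define s where "s = norm (coord k u0)"
  have s: "s > 0" using u0k by (simp add: s_def)
  have u1: "coord 1 u = of_real s"
    using uh(3)[of k] \<pi>(2) u0k by (simp add: \<epsilon>_def s_def)
  have "h (e 1) * of_real s = of_real s * of_real s"
    using reflection_coord(1)[OF uh(1), of 1] s unfolding same u1 by simp
  then have h1: "h (e 1) = of_real s" using s by simp
  have "(\<Sum>k\<in>{0,1::nat}. norm (h (e k)) * norm (coord k u)) \<le> 1"
    by (rule reflection_partial_sum_le[OF uh(1)]) simp
  then have "norm (coord 0 u) * norm (coord 0 u) + norm (coord 1 u) * norm (coord 1 u) \<le> 1"
    by (simp add: same)
  then have "norm (coord 0 u) * norm (coord 0 u) + s * s \<le> 1"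
    unfolding u1 using s by simp
  moreover have "norm (coord 0 u) * norm (coord 0 u) > 0" using \<open>coord 0 u \<noteq> 0\<close> by simp
  ultimately have "s * s < 1" by linarith
  then have "s < 1" using s by (metis abs_square_less_1 abs_of_pos power2_eq_square)
  with uh(1) s near u1 h1 h0 same show ?thesis
    by (intro exI[of _ u] exI[of _ h] exI[of _ s]) (simp add: \<delta>'_def)
qed

text \<open>The vector \<open>u\<close> makes the angle \<open>\<beta> = arcsin s\<close> with the unit vector \<open>z\<close> orthogonal to \<open>e 1\<close> in
  the plane of \<open>u\<close> and \<open>e 1\<close>. Changing the sign of the coordinate 1 gives a reflection at the
  angle \<open>-\<beta>\<close>; the product of the two is the rotation by \<open>4 \<beta>\<close>.\<close>
lemma fnorm_rotation:
  assumes r: "isometric_reflection u h" and s: "0 < s" "s < 1"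
    and u1: "coord 1 u = of_real s" and h1: "h (e 1) = of_real s"
    and C: "C = of_real (sqrt (1 - s\<^sup>2))"
    and z: "z = smul (inverse C) (u - smul (of_real s) (e 1))"
    and \<zeta>: "\<zeta> = (\<lambda>x. inverse C * (h x - of_real s * coord 1 x))"
  shows "fnorm (rotation z \<zeta> (e 1) (coord 1) (real m * (4 * arcsin s)) x) = fnorm x"
proof -
  define \<beta> where "\<beta> = arcsin s"
  have sin: "sin \<beta> = s" using s by (simp add: \<beta>_def)
  have cos: "cos \<beta> = sqrt (1 - s\<^sup>2)" using s by (simp add: \<beta>_def cos_arcsin)
  have "s\<^sup>2 < 1" using s by (simp add: power2_eq_square mult_less_cancel_left_pos abs_square_less_1 flip: power2_eq_square)
  then have C0: "C \<noteq> 0" and CC: "C * C = 1 - of_real s * of_real s"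
    by (simp_all add: C power2_eq_square flip: of_real_mult)
  let ?S = "of_real s :: 'k"
  have \<zeta>_add: "\<zeta> (x + y) = \<zeta> x + \<zeta> y" and \<zeta>_smul: "\<zeta> (smul a x) = a * \<zeta> x" for x y a
    unfolding \<zeta> by (simp_all add: reflection_add[OF r] reflection_smul[OF r] algebra_simps)
  have dual: "\<zeta> z = 1" "\<zeta> (e 1) = 0" "coord 1 z = 0"
  proof -
    show "\<zeta> (e 1) = 0" unfolding \<zeta> h1 by simp
    show "coord 1 z = 0" unfolding z coord_smul coord_diff u1 by simp
    have "\<zeta> z = inverse C * (inverse C * (1 - ?S * ?S))"
      unfolding \<zeta> z reflection_smul[OF r] reflection_diff[OF r] reflection_self[OF r] coord_smul coord_diff h1 u1
      by simp
    then show "\<zeta> z = 1" using C0 by (simp add: field_simps flip: CC)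
  qed
  have u: "u = smul C z + smul ?S (e 1)"
    using C0 by (simp add: z)
  have h: "h x = C * \<zeta> x + ?S * coord 1 x" for x
    using C0 by (simp add: \<zeta> flip: mult.assoc)
  define u' where "u' = reflect (e 1) (coord 1) u"
  define h' where "h' x = h (reflect (e 1) (coord 1) x)" for x
  note R = reflect_Iso[OF coord_reflection[of 1]]
  have r': "isometric_reflection u' h'"
    using reflection_conj[OF R r] unfolding u'_def h'_def by (simp add: inv_reflect[OF coord_reflection])
  have u': "u' = smul C z - smul ?S (e 1)"
  proof -
    have "u' = u - smul (2 * ?S) (e 1)"
      unfolding u'_def reflect_def u1 ..
    also have "\<dots> = smul C z + smul ?S (e 1) - smul (2 * ?S) (e 1)"
      by (simp only: u[symmetric])
    also have "smul (2 * ?S) (e 1) = smul ?S (e 1) + smul ?S (e 1)"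
      by (simp only: mult_2 scale_left_distrib)
    finally show ?thesis by simp
  qed
  have h': "h' x = C * \<zeta> x - ?S * coord 1 x" for x
    unfolding h'_def reflect_def reflection_diff[OF r] reflection_smul[OF r] h1 by (simp add: h)
  let ?R = "rotation z \<zeta> (e 1) (coord 1)"
  have R4: "fnorm (?R (4 * \<beta>) x) = fnorm x" for x
  proof -
    have "?R (4 * \<beta>) x = reflect u h (reflect u' h' x)"
      by (rule reflect_reflect_eq_rotation[symmetric, where c = C and s = ?S])
         (simp_all add: \<zeta>_add \<zeta>_smul dual dual[unfolded One_nat_def] u h u' h' cos sin C)
    then show ?thesis
      by (simp add: Iso_fnorm[OF reflect_Iso[OF r]] Iso_fnorm[OF reflect_Iso[OF r']])
  qed
  have "fnorm (?R (real m * (4 * \<beta>)) x) = fnorm x" for x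
  proof (induction m arbitrary: x)
    case (Suc m)
    have "?R (real (Suc m) * (4 * \<beta>)) x = ?R (real m * (4 * \<beta>)) (?R (4 * \<beta>) x)"
      by (subst rotation_rotation) (simp_all add: \<zeta>_add \<zeta>_smul dual dual[unfolded One_nat_def] algebra_simps)
    then show ?case by (simp only: Suc R4)
  qed (simp add: rotation_def)
  then show ?thesis by (simp add: \<beta>_def)
qed

text \<open>Isometric rotations by small angles, in planes that tend to the plane of \<open>e 0\<close> and \<open>e 1\<close>, have
  powers that tend to any given rotation of that plane.\<close>
lemma fnorm_rotation_limit:
  assumes small: small_reflections
    and fin: "finite {k. coord k x \<noteq> 0}" and \<theta>: "\<theta> \<ge> 0"
  shows "fnorm (rotation (e 0) (coord 0) (e 1) (coord 1) \<theta> x) = fnorm x"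
proof -
  have "\<forall>i. \<exists>u h s. isometric_reflection u h \<and> 0 < s \<and> s < 1 \<and> fnorm (u - e 0) < inverse (real (Suc i)) \<and>
    coord 1 u = of_real s \<and> h (e 1) = of_real s \<and> h (e 0) = coord 0 u \<and>
    (\<forall>k. norm (h (e k)) = norm (coord k u))"
    by (intro allI ex_reflection_near_e0[OF small]) simp_all
  then obtain u h s where r: "\<And>i. isometric_reflection (u i) (h i)"
    and s: "\<And>i. 0 < s i" "\<And>i. s i < 1" and near: "\<And>i. fnorm (u i - e 0) < inverse (real (Suc i))"
    and u1: "\<And>i. coord 1 (u i) = of_real (s i)" and h1: "\<And>i. h i (e 1) = of_real (s i)"
    and h0: "\<And>i. h i (e 0) = coord 0 (u i)"
    and same: "\<And>i k. norm (h i (e k)) = norm (coord k (u i))"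
    by metis
  have u: "fconv u (e 0)"
    using near LIMSEQ_inverse_real_of_nat by (intro fconv_squeeze[of u _ "\<lambda>i. inverse (real (Suc i))"]) (auto intro: less_imp_le)
  have he: "(\<lambda>i. h i (e k)) \<longlonglongrightarrow> coord 0 (e k)" for k
  proof (cases "k = 0")
    case True
    then show ?thesis using coord_fconv[OF u, of 0] by (simp add: h0)
  next
    case False
    have "(\<lambda>i. norm (h i (e k))) \<longlonglongrightarrow> norm (coord k (e 0))"
      unfolding same by (intro tendsto_norm coord_fconv u)
    then show ?thesis using False by (simp add: coord_e tendsto_norm_zero_iff)
  qed
  obtain N where N: "x = (\<Sum>k<N. smul (coord k x) (e k))"
    using finite_expansion[OF fin] by blast
  have hx: "(\<lambda>i. h i x) \<longlonglongrightarrow> coord 0 x"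
  proof -
    have "h i x = (\<Sum>k<N. coord k x * h i (e k))" for i
      by (subst N) (simp add: reflection_sum[OF r] reflection_smul[OF r])
    moreover have "coord 0 x = (\<Sum>k<N. coord k x * coord 0 (e k))"
      by (subst N) simp
    moreover have "(\<lambda>i. \<Sum>k<N. coord k x * h i (e k)) \<longlonglongrightarrow> (\<Sum>k<N. coord k x * coord 0 (e k))"
      by (intro tendsto_intros he)
    ultimately show ?thesis by simp
  qed
  have s_lim: "s \<longlonglongrightarrow> 0"
  proof -
    have "(\<lambda>i. of_real (s i) :: 'k) \<longlonglongrightarrow> coord 1 (e 0)"
      using coord_fconv[OF u, of 1] unfolding u1 .
    then have "(\<lambda>i. of_real (s i) :: 'k) \<longlonglongrightarrow> of_real 0" by (simp add: coord_e)
    then show ?thesis by (simp only: tendsto_of_real_iff)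
  qed
  define C where "C i = (of_real (sqrt (1 - (s i)\<^sup>2)) :: 'k)" for i
  have C: "(\<lambda>i. inverse (C i)) \<longlonglongrightarrow> inverse (of_real (sqrt (1 - 0\<^sup>2)))"
    unfolding C_def by (intro tendsto_intros s_lim) simp
  define z where "z i = smul (inverse (C i)) (u i - smul (of_real (s i)) (e 1))" for i
  define \<zeta> where "\<zeta> i = (\<lambda>x. inverse (C i) * (h i x - of_real (s i) * coord 1 x))" for i
  have "fconv z (smul (inverse (of_real (sqrt (1 - 0\<^sup>2)))) (e 0 - smul (of_real 0) (e 1)))"
    unfolding z_def by (intro fconv_smul C fconv_diff u tendsto_of_real s_lim fconv_const)
  then have z: "fconv z (e 0)" by simp
  have "(\<lambda>i. \<zeta> i x) \<longlonglongrightarrow> inverse (of_real (sqrt (1 - 0\<^sup>2))) * (coord 0 x - of_real 0 * coord 1 x)"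
    unfolding \<zeta>_def by (intro tendsto_intros C hx s_lim)
  then have \<zeta>: "(\<lambda>i. \<zeta> i x) \<longlonglongrightarrow> coord 0 x" by simp
  define \<beta> where "\<beta> i = 4 * arcsin (s i)" for i
  \<comment> \<open>the number of steps of size \<open>\<beta> i\<close> that comes closest to \<open>\<theta>\<close> from below\<close>
  define m where "m i = nat \<lfloor>\<theta> / \<beta> i\<rfloor>" for i
  have \<beta>: "\<beta> i > 0" for i
    using arcsin_less_arcsin[of 0 "s i"] s[of i] by (simp add: \<beta>_def)
  have "isCont arcsin 0" by (rule isCont_arcsin) auto
  then have "(\<lambda>i. arcsin (s i)) \<longlonglongrightarrow> arcsin 0"
    using s_lim by (rule isCont_tendsto_compose)
  then have \<beta>_lim: "\<beta> \<longlonglongrightarrow> 0"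
    unfolding \<beta>_def by (intro tendsto_mult_right_zero) simp
  have "\<bar>real (m i) * \<beta> i - \<theta>\<bar> \<le> \<beta> i" for i
  proof -
    have "\<theta> / \<beta> i \<ge> 0" using \<theta> \<beta>[of i] by simp
    then have "real (m i) \<le> \<theta> / \<beta> i" "\<theta> / \<beta> i \<le> real (m i) + 1"
      unfolding m_def by linarith+
    then show ?thesis using \<beta>[of i] by (simp add: field_simps abs_le_iff)
  qed
  then have "(\<lambda>i. real (m i) * \<beta> i - \<theta>) \<longlonglongrightarrow> 0"
    by (intro Lim_null_comparison[OF _ \<beta>_lim]) simp
  then have angle: "(\<lambda>i. real (m i) * \<beta> i) \<longlonglongrightarrow> \<theta>" by (rule LIM_zero_cancel)
  have "fconv (\<lambda>i. rotation (z i) (\<zeta> i) (e 1) (coord 1) (real (m i) * \<beta> i) x)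
      (rotation (e 0) (coord 0) (e 1) (coord 1) \<theta> x)"
    unfolding rotation_def by (intro fconv_add fconv_smul fconv_const z tendsto_intros \<zeta> angle)
  then have "(\<lambda>i. fnorm (rotation (z i) (\<zeta> i) (e 1) (coord 1) (real (m i) * \<beta> i) x))
      \<longlonglongrightarrow> fnorm (rotation (e 0) (coord 0) (e 1) (coord 1) \<theta> x)"
    by (rule fconv_fnorm)
  moreover have "fnorm (rotation (z i) (\<zeta> i) (e 1) (coord 1) (real (m i) * \<beta> i) x) = fnorm x" for i
    unfolding \<beta>_def by (rule fnorm_rotation[OF r s u1 h1 C_def z_def \<zeta>_def])
  ultimately show ?thesis by (simp add: LIMSEQ_const_iff)
qed

text \<open>A rotation in the plane of \<open>e 0\<close> and \<open>e k\<close>, which a permutation moves to that of \<open>e 0\<close> and \<open>e 1\<close>,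
  makes the coordinate \<open>k\<close> vanish.\<close>
lemma fnorm_rotate_to_e0:
  assumes small: small_reflections
    and fin: "finite {k. coord k y \<noteq> 0}" and k: "k \<noteq> 0"
    and x: "coord 0 x = of_real a" "coord k x = of_real b"
    and y: "coord 0 y = of_real (sqrt (a\<^sup>2 + b\<^sup>2))" "coord k y = 0"
    and xy: "\<And>i. i \<noteq> 0 \<Longrightarrow> i \<noteq> k \<Longrightarrow> coord i x = coord i y"
  shows "fnorm x = fnorm y"
proof -
  define r where "r = sqrt (a\<^sup>2 + b\<^sup>2)"
  obtain \<theta> where \<theta>: "\<theta> \<ge> 0" "a = r * cos \<theta>" "b = r * sin \<theta>"
  proof (cases "r = 0")
    case True
    then have "a = 0" "b = 0" by (simp_all add: r_def sum_power2_eq_zero_iff)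
    with True show ?thesis by (intro that[of 0]) simp_all
  next
    case False
    have "r\<^sup>2 = a\<^sup>2 + b\<^sup>2" by (simp add: r_def)
    then have "(a / r)\<^sup>2 + (b / r)\<^sup>2 = 1"
      using False unfolding power_divide add_divide_distrib[symmetric] by (metis divide_self power_eq_0_iff)
    then obtain t where "0 \<le> t" "a / r = cos t" "b / r = sin t"
      using sincos_total_2pi_le by blast
    with False show ?thesis by (intro that[of t]) (auto simp: field_simps)
  qed
  have x': "coord 0 x = of_real r * of_real (cos \<theta>)" "coord k x = of_real r * of_real (sin \<theta>)"
    using x by (simp_all add: \<theta>(2,3))
  have y': "coord 0 y = of_real r" by (simp add: y r_def)
  have \<epsilon>: "unimodular (\<lambda>_. 1)" by (simp add: unimodular_def)
  define \<pi> where "\<pi> = Transposition.transpose 1 k"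
  have \<pi>: "bij \<pi>" and \<pi>0: "\<pi> 0 = 0" and \<pi>k: "\<pi> k = 1" using k by (auto simp: \<pi>_def Transposition.transpose_def)
  let ?M = "monomial (\<lambda>_. 1) \<pi>"
  have M: "coord (\<pi> n) (?M v) = coord n v" for n v by (simp add: coord_monomial[OF \<epsilon> \<pi>])
  note M0 = M[of 0, unfolded \<pi>0] and Mk = M[of k, unfolded \<pi>k]
  have "{n. coord n (?M y) \<noteq> 0} \<subseteq> \<pi> ` {n. coord n y \<noteq> 0}"
  proof
    fix n assume "n \<in> {n. coord n (?M y) \<noteq> 0}"
    moreover have "\<pi> (\<pi> n) = n" by (simp add: \<pi>_def)
    ultimately show "n \<in> \<pi> ` {n. coord n y \<noteq> 0}"
      using M[of "\<pi> n" y] by (intro image_eqI[of _ _ "\<pi> n"]) auto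
  qed
  then have fin': "finite {n. coord n (?M y) \<noteq> 0}" using fin by (meson finite_imageI finite_subset)
  have "rotation (e 0) (coord 0) (e 1) (coord 1) \<theta> (?M y) = ?M x"
  proof (rule coord_eqI_bij[OF \<epsilon> \<pi>])
    fix n
    have "\<pi> n = 0 \<longleftrightarrow> n = 0" "\<pi> n = 1 \<longleftrightarrow> n = k"
      using \<pi>0 \<pi>k \<pi> by (metis bij_is_inj inj_eq)+
    then have e: "coord (\<pi> n) (e 0) = (if n = 0 then 1 else 0)" "coord (\<pi> n) (e 1) = (if n = k then 1 else 0)"
      by (auto simp: coord_e)
    show "coord (\<pi> n) (rotation (e 0) (coord 0) (e 1) (coord 1) \<theta> (?M y)) = coord (\<pi> n) (?M x)"
      unfolding rotation_def coord_add coord_smul M e M0 Mk y(2) y'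
      using x' y' y(2) k xy[of n] by (auto simp: algebra_simps)
  qed
  then have "fnorm (?M x) = fnorm (?M y)"
    using fnorm_rotation_limit[OF small fin' \<theta>(1)] by metis
  then show ?thesis by (simp add: fnorm_monomial[OF \<epsilon> \<pi>])
qed

lemma fnorm_sum_nonneg:
  assumes small: small_reflections
  shows "(\<And>k. c k \<ge> 0) \<Longrightarrow> fnorm (\<Sum>k\<le>n. smul (of_real (c k)) (e k)) =
    fnorm (smul (of_real (sqrt (\<Sum>k\<le>n. (c k)\<^sup>2))) (e 0))"
proof (induction n arbitrary: c)
  case 0
  then show ?case by simp
next
  case (Suc n)
  define c' where "c' k = (if k = 0 then sqrt ((c 0)\<^sup>2 + (c (Suc n))\<^sup>2) else c k)" for k
  let ?x = "\<Sum>k\<le>Suc n. smul (of_real (c k)) (e k)" and ?y = "\<Sum>k\<le>n. smul (of_real (c' k)) (e k)"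
  have coord_sum: "coord i (\<Sum>k\<le>m. smul (of_real (d k)) (e k)) = (if i \<le> m then of_real (d i) else 0)"
    for d m i
  proof -
    have "(\<Sum>k\<le>m. of_real (d k) * coord i (e k)) = (\<Sum>k\<le>m. if k = i then of_real (d i) else 0)"
      by (intro sum.cong) (auto simp: coord_e)
    then show ?thesis by simp
  qed
  have "fnorm ?x = fnorm ?y"
  proof (rule fnorm_rotate_to_e0[OF small])
    have "{k. coord k ?y \<noteq> 0} \<subseteq> {..n}" unfolding coord_sum by auto
    then show "finite {k. coord k ?y \<noteq> 0}" by (rule finite_subset) simp
    show "coord 0 ?y = of_real (sqrt ((c 0)\<^sup>2 + (c (Suc n))\<^sup>2))"
      unfolding coord_sum by (simp add: c'_def)
    show "coord i ?x = coord i ?y" if "i \<noteq> 0" "i \<noteq> Suc n" for i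
      unfolding coord_sum using that by (simp add: c'_def le_Suc_eq)
  qed (unfold coord_sum, simp_all)
  also have "\<dots> = fnorm (smul (of_real (sqrt (\<Sum>k\<le>n. (c' k)\<^sup>2))) (e 0))"
    by (rule Suc.IH) (simp add: c'_def Suc.prems)
  also have "(\<Sum>k\<le>n. (c' k)\<^sup>2) = (\<Sum>k\<le>Suc n. (c k)\<^sup>2)"
  proof -
    have "(\<Sum>k\<in>{..n} - {0}. (c' k)\<^sup>2) = (\<Sum>k\<in>{..n} - {0}. (c k)\<^sup>2)"
      by (intro sum.cong) (auto simp: c'_def)
    then show ?thesis
      by (simp add: sum.remove[of "{..n}" 0] c'_def)
  qed
  finally show ?case .
qed

text \<open>After a change of phases, all coefficients are nonnegative and the rotations apply.\<close>
lemma fnorm_sum: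
  assumes small: small_reflections
  shows "fnorm (\<Sum>k<n. smul (c k) (e k)) = fnorm (smul (of_real (sqrt (\<Sum>k<n. (norm (c k))\<^sup>2))) (e 0))"
proof (cases n)
  case (Suc m)
  define \<epsilon> where "\<epsilon> k = (if c k = 0 then 1 else of_real (norm (c k)) / c k)" for k
  have \<epsilon>: "unimodular \<epsilon>" by (simp add: unimodular_def \<epsilon>_def norm_divide)
  have \<pi>: "bij (id :: nat \<Rightarrow> nat)" by simp
  note M = monomial_Iso[OF \<epsilon> \<pi>]
  have "c k * \<epsilon> k = of_real (norm (c k))" for k by (simp add: \<epsilon>_def)
  then have "monomial \<epsilon> id (\<Sum>k<n. smul (c k) (e k)) = (\<Sum>k\<le>m. smul (of_real (norm (c k))) (e k))"
    by (simp add: Suc lessThan_Suc_atMost Iso_sum[OF M] Iso_smul[OF M] monomial_e[OF \<epsilon> \<pi>])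
  then have "fnorm (\<Sum>k<n. smul (c k) (e k)) = fnorm (\<Sum>k\<le>m. smul (of_real (norm (c k))) (e k))"
    using fnorm_monomial[OF \<epsilon> \<pi>] by metis
  also have "\<dots> = fnorm (smul (of_real (sqrt (\<Sum>k\<le>m. (norm (c k))\<^sup>2))) (e 0))"
    by (rule fnorm_sum_nonneg[OF small]) simp
  finally show ?thesis by (simp add: Suc lessThan_Suc_atMost)
qed simp

end

section \<open>The isomorphism with the Hilbert sequence space\<close>

lemma (in F_space) Cauchy_fconv:
  assumes "\<And>\<delta>. \<delta> > 0 \<Longrightarrow> \<exists>M. \<forall>m\<ge>M. \<forall>n\<ge>m. fnorm (X n - X m) < \<delta>"
  shows "\<exists>x. fconv X x"
proof -
  interpret M: Metric_space UNIV "fdist fnorm" by (rule Metric_space_fdist)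
  have "M.MCauchy X"
    unfolding M.MCauchy_def
  proof (intro conjI allI impI)
    fix \<delta> :: real assume "\<delta> > 0"
    then obtain M where M: "\<And>m n. m \<ge> M \<Longrightarrow> n \<ge> m \<Longrightarrow> fnorm (X n - X m) < \<delta>"
      using assms by blast
    have "fdist fnorm (X n) (X n') < \<delta>" if "M \<le> n" "M \<le> n'" for n n'
      using M[of n n'] M[of n' n] that fnorm_diff_commute[of "X n" "X n'"]
      by (cases "n \<le> n'") (auto simp: fdist_def)
    then show "\<exists>N. \<forall>n n'. N \<le> n \<longrightarrow> N \<le> n' \<longrightarrow> fdist fnorm (X n) (X n') < \<delta>" by blast
  qed simp
  then have "\<exists>x. limitin M.mtopology X x sequentially"
    using complete unfolding M.mcomplete_def by blast
  then show ?thesis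
    using limitin_ftopology_iff unfolding ftopology_def by simp
qed

context symmetric_basis_space
begin

text \<open>By symmetry, the F-norm of \<open>t (e n)\<close> for every \<open>n\<close>.\<close>
definition \<phi> :: "real \<Rightarrow> real"
  where "\<phi> t = fnorm (smul (of_real t) (e 0))"

lemma \<phi>_mono: "0 \<le> s \<Longrightarrow> s \<le> t \<Longrightarrow> \<phi> s \<le> \<phi> t"
  unfolding \<phi>_def by (intro fnorm_smul_mono) simp

lemma \<phi>_pos: "0 < t \<Longrightarrow> 0 < \<phi> t"
  unfolding \<phi>_def by (intro fnorm_pos) simp

lemma \<phi>_small:
  assumes "\<delta> > 0"
  obtains t where "t > 0" "\<phi> t < \<delta>"
proof -
  have "(\<lambda>n. of_real (inverse (real (Suc n))) :: 'k) \<longlonglongrightarrow> of_real 0"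
    by (intro tendsto_of_real LIMSEQ_inverse_real_of_nat)
  then have "(\<lambda>n. \<phi> (inverse (real (Suc n)))) \<longlonglongrightarrow> 0"
    unfolding \<phi>_def smul_tendsto_zero_iff[OF e_nonzero] by simp
  then have "eventually (\<lambda>n. \<phi> (inverse (real (Suc n))) < \<delta>) sequentially"
    using assms by (rule order_tendstoD)
  then obtain n where "\<phi> (inverse (real (Suc n))) < \<delta>"
    by (auto simp: eventually_sequentially)
  then show ?thesis by (intro that[of "inverse (real (Suc n))"]) simp_all
qed

lemma \<phi>_less_imp: "\<phi> s < \<phi> t \<Longrightarrow> 0 \<le> t \<Longrightarrow> s < t"
  using \<phi>_mono[of t s] by force

context
  assumes small: small_reflections
begin

lemma fnorm_partial_sum_diff:
  assumes "m \<le> n"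
  shows "fnorm ((\<Sum>k<n. smul (c k) (e k)) - (\<Sum>k<m. smul (c k) (e k))) = \<phi> (sqrt (\<Sum>k=m..<n. (norm (c k))\<^sup>2))"
proof -
  define d where "d k = (if k < m then 0 else c k)" for k
  have un: "{..<n} = {..<m} \<union> {m..<n}" using assms by auto
  have "(\<Sum>k<n. smul (c k) (e k)) = (\<Sum>k<m. smul (c k) (e k)) + (\<Sum>k=m..<n. smul (c k) (e k))"
    unfolding un by (rule sum.union_disjoint) auto
  moreover have "(\<Sum>k<n. smul (d k) (e k)) = (\<Sum>k=m..<n. smul (c k) (e k))"
    unfolding un by (subst sum.union_disjoint) (auto simp: d_def intro!: sum.cong)
  moreover have "(\<Sum>k<n. (norm (d k))\<^sup>2) = (\<Sum>k=m..<n. (norm (c k))\<^sup>2)"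
    unfolding un by (subst sum.union_disjoint) (auto simp: d_def intro!: sum.cong)
  ultimately show ?thesis
    using fnorm_sum[OF small, of d n] by (simp add: \<phi>_def)
qed

lemma partial_sum_lim: "(\<lambda>n. \<phi> (sqrt (\<Sum>k<n. (norm (coord k x))\<^sup>2))) \<longlonglongrightarrow> fnorm x"
  using fconv_fnorm[OF coord_expansion[of x]] by (simp add: fnorm_sum[OF small] \<phi>_def)

text \<open>The partial sums form a Cauchy sequence, so that from some index on the Euclidean norms of their
  differences are less than 1.\<close>
lemma coord_ell2: "(\<lambda>k. coord k x) \<in> ell2"
proof -
  have "(\<lambda>n. fnorm ((\<Sum>k<n. smul (coord k x) (e k)) - x)) \<longlonglongrightarrow> 0"
    using coord_expansion[of x] by (simp add: fconv_def)
  moreover have "0 < \<phi> 1 / 2" using \<phi>_pos[of 1] by simp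
  ultimately have "eventually (\<lambda>n. fnorm ((\<Sum>k<n. smul (coord k x) (e k)) - x) < \<phi> 1 / 2) sequentially"
    by (rule order_tendstoD)
  then obtain M where M: "\<And>n. n \<ge> M \<Longrightarrow> fnorm ((\<Sum>k<n. smul (coord k x) (e k)) - x) < \<phi> 1 / 2"
    by (auto simp: eventually_sequentially)
  have "(\<Sum>k=M..<n. (norm (coord k x))\<^sup>2) \<le> 1" for n
  proof (cases "M \<le> n")
    case True
    have "\<phi> (sqrt (\<Sum>k=M..<n. (norm (coord k x))\<^sup>2)) < \<phi> 1"
      unfolding fnorm_partial_sum_diff[OF True, symmetric]
      using fnorm_diff_triangle[of "\<Sum>k<n. smul (coord k x) (e k)" "\<Sum>k<M. smul (coord k x) (e k)" x]
        M[OF True] M[of M] fnorm_diff_commute[of x "\<Sum>k<M. smul (coord k x) (e k)"] by simp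
    then show ?thesis using \<phi>_less_imp[of _ 1] by force
  qed simp
  moreover have "(\<Sum>k<n. (norm (coord k x))\<^sup>2) \<le> (\<Sum>k<M. (norm (coord k x))\<^sup>2) + (\<Sum>k=M..<n. (norm (coord k x))\<^sup>2)" for n
    by (subst sum.union_disjoint[symmetric]) (auto intro!: sum_mono2)
  ultimately have "(\<Sum>k<n. (norm (coord k x))\<^sup>2) \<le> (\<Sum>k<M. (norm (coord k x))\<^sup>2) + 1" for n
    by (meson add_left_mono order_trans)
  then show ?thesis
    unfolding ell2_def by (auto intro!: summableI_nonneg_bounded)
qed

lemma ex_coord_ell2:
  assumes "c \<in> ell2"
  obtains x where "\<And>k. coord k x = c k"
proof -
  have "\<exists>x. fconv (\<lambda>N. \<Sum>k<N. smul (c k) (e k)) x"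
  proof (rule Cauchy_fconv)
    fix \<delta> :: real assume "\<delta> > 0"
    then obtain t where t: "t > 0" "\<phi> t < \<delta>" by (rule \<phi>_small)
    have "summable (\<lambda>k. (norm (c k))\<^sup>2)" using assms by (simp add: ell2_def)
    moreover have "t\<^sup>2 > 0" using t by simp
    ultimately obtain M where M: "\<And>m n. m \<ge> M \<Longrightarrow> norm (\<Sum>k=m..<n. (norm (c k))\<^sup>2) < t\<^sup>2"
      unfolding summable_Cauchy by blast
    have "fnorm ((\<Sum>k<n. smul (c k) (e k)) - (\<Sum>k<m. smul (c k) (e k))) < \<delta>" if "m \<ge> M" "n \<ge> m" for m n
    proof -
      have "(\<Sum>k=m..<n. (norm (c k))\<^sup>2) \<le> t\<^sup>2" using M[OF that(1), of n] by simp
      then have "sqrt (\<Sum>k=m..<n. (norm (c k))\<^sup>2) \<le> t"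
        using t by (simp add: real_le_lsqrt sum_nonneg)
      then have "\<phi> (sqrt (\<Sum>k=m..<n. (norm (c k))\<^sup>2)) \<le> \<phi> t"
        by (intro \<phi>_mono) (simp_all add: sum_nonneg)
      with t(2) show ?thesis by (simp add: fnorm_partial_sum_diff[OF that(2)])
    qed
    then show "\<exists>M. \<forall>m\<ge>M. \<forall>n\<ge>m. fnorm ((\<Sum>k<n. smul (c k) (e k)) - (\<Sum>k<m. smul (c k) (e k))) < \<delta>"
      by blast
  qed
  then show ?thesis using that coord_unique by blast
qed

lemma sqrt_partial_sum_le: "sqrt (\<Sum>k<n. (norm (coord k x))\<^sup>2) \<le> ell2_norm (\<lambda>k. coord k x)"
proof -
  have "summable (\<lambda>k. (norm (coord k x))\<^sup>2)" using coord_ell2[of x] by (simp add: ell2_def)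
  then have "(\<Sum>k<n. (norm (coord k x))\<^sup>2) \<le> (\<Sum>k. (norm (coord k x))\<^sup>2)"
    by (intro sum_le_suminf) auto
  then show ?thesis using coord_ell2[of x] by (simp add: ell2_norm_def)
qed

text \<open>This lemma and the next compare the two topologies: small Euclidean norm means small F-norm and
  conversely.\<close>
lemma fnorm_le_\<phi>:
  assumes "ell2_norm (\<lambda>k. coord k x) \<le> t"
  shows "fnorm x \<le> \<phi> t"
proof (rule LIMSEQ_le_const2[OF partial_sum_lim], intro exI allI impI)
  fix n
  show "\<phi> (sqrt (\<Sum>k<n. (norm (coord k x))\<^sup>2)) \<le> \<phi> t"
    using sqrt_partial_sum_le[where n = n and x = x] assms by (intro \<phi>_mono) (auto intro: sum_nonneg)
qed

lemma \<phi>_le_fnorm: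
  assumes "t \<ge> 0" "t < ell2_norm (\<lambda>k. coord k x)"
  shows "\<phi> t \<le> fnorm x"
proof -
  have s: "summable (\<lambda>k. (norm (coord k x))\<^sup>2)" using coord_ell2[of x] by (simp add: ell2_def)
  have "(\<lambda>n. sqrt (\<Sum>k<n. (norm (coord k x))\<^sup>2)) \<longlonglongrightarrow> ell2_norm (\<lambda>k. coord k x)"
    using coord_ell2[of x] summable_LIMSEQ[OF s] by (simp add: ell2_norm_def tendsto_real_sqrt)
  then have "eventually (\<lambda>n. t < sqrt (\<Sum>k<n. (norm (coord k x))\<^sup>2)) sequentially"
    using assms(2) by (rule order_tendstoD)
  then obtain N where N: "\<And>n. n \<ge> N \<Longrightarrow> t < sqrt (\<Sum>k<n. (norm (coord k x))\<^sup>2)"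
    by (auto simp: eventually_sequentially)
  show ?thesis
  proof (rule LIMSEQ_le_const[OF partial_sum_lim], intro exI allI impI)
    fix n assume "N \<le> n"
    then show "\<phi> t \<le> \<phi> (sqrt (\<Sum>k<n. (norm (coord k x))\<^sup>2))"
      using N[of n] assms(1) by (intro \<phi>_mono) auto
  qed
qed

lemma isomorphic_to_ell2: "isomorphic_to_ell2 smul fnorm"
  unfolding isomorphic_to_ell2_def
proof (intro exI conjI)
  let ?T = "\<lambda>x k. coord k x"
  show "Vector_Spaces.linear smul seq_smul ?T"
    unfolding Vector_Spaces.linear_iff using vector_space_smul vector_space_seq_smul
    by (auto simp: seq_smul_def fun_eq_iff)
  interpret X: Metric_space UNIV "fdist fnorm" by (rule Metric_space_fdist)
  interpret L: Metric_space "ell2 :: (nat \<Rightarrow> 'k) set" "\<lambda>f g. ell2_norm (f - g)" by (rule Metric_space_ell2)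
  have diff: "?T x - ?T y = ?T (x - y)" for x y by (simp add: fun_eq_iff)
  define g where "g c = (SOME x. ?T x = c)" for c
  have Tg: "?T (g c) = c" if "c \<in> ell2" for c
  proof -
    have "\<exists>x. ?T x = c" using ex_coord_ell2[OF that] by (metis ext)
    then show ?thesis unfolding g_def by (rule someI_ex)
  qed
  have gT: "g (?T x) = x" for x
    using Tg[OF coord_ell2[of x]] by (intro coord_eqI) (simp add: fun_eq_iff)
  have "continuous_map (ftopology fnorm) ell2_topology ?T"
    unfolding ftopology_def ell2_topology_def X.metric_continuous_map[OF Metric_space_ell2]
  proof (intro conjI ballI allI impI)
    show "?T ` UNIV \<subseteq> ell2" using coord_ell2 by blast
    fix a and \<delta> :: real assume "\<delta> > 0"
    have "ell2_norm (?T a - ?T x) < \<delta>" if "fdist fnorm a x < \<phi> (\<delta> / 2)" for x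
      using \<phi>_le_fnorm[of "\<delta> / 2" "a - x"] that \<open>\<delta> > 0\<close> unfolding diff fdist_def by force
    then show "\<exists>\<eta>>0. \<forall>x. x \<in> UNIV \<and> fdist fnorm a x < \<eta> \<longrightarrow> ell2_norm (?T a - ?T x) < \<delta>"
      using \<phi>_pos[of "\<delta> / 2"] \<open>\<delta> > 0\<close> by (intro exI[of _ "\<phi> (\<delta> / 2)"]) auto
  qed
  moreover have "continuous_map ell2_topology (ftopology fnorm) g"
    unfolding ftopology_def ell2_topology_def L.metric_continuous_map[OF Metric_space_fdist]
  proof (intro conjI ballI allI impI)
    fix a :: "nat \<Rightarrow> 'k" and \<delta> :: real assume a: "a \<in> ell2" and "\<delta> > 0"
    then obtain t where t: "t > 0" "\<phi> t < \<delta>" by (meson \<phi>_small)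
    have "fdist fnorm (g a) (g c) < \<delta>" if "c \<in> ell2" "ell2_norm (a - c) < t" for c
    proof -
      have "?T (g a - g c) = a - c"
        using diff[of "g a" "g c"] Tg[OF a] Tg[OF that(1)] by simp
      then show ?thesis
        using fnorm_le_\<phi>[of "g a - g c" t] that(2) t(2) by (simp add: fdist_def)
    qed
    with t show "\<exists>\<eta>>0. \<forall>c. c \<in> ell2 \<and> ell2_norm (a - c) < \<eta> \<longrightarrow> fdist fnorm (g a) (g c) < \<delta>"
      by blast
  qed simp
  ultimately have "homeomorphic_maps (ftopology fnorm) ell2_topology ?T g"
    unfolding homeomorphic_maps_def using gT Tg
    by (auto simp: ell2_topology_def)
  then show "homeomorphic_map (ftopology fnorm) ell2_topology ?T"
    by (rule homeomorphic_maps_imp_map)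
qed

end

section \<open>Algebraic reflexivity\<close>

text \<open>If \<open>e n\<close> were mapped elsewhere, there would be isometric reflections that move \<open>e 0\<close> arbitrarily
  little, hence all rotations of coordinate planes, and the space would be isomorphic to \<open>\<ell>\<^sub>2\<close>.\<close>
lemma Iso_e:
  assumes T: "T \<in> Iso smul fnorm" and not_ell2: "\<not> isomorphic_to_ell2 smul fnorm"
  shows "\<exists>a k. norm a = 1 \<and> T (e n) = smul a (e k)"
proof (rule ccontr)
  assume neg: "\<nexists>a k. norm a = 1 \<and> T (e n) = smul a (e k)"
  obtain v f where vf: "isometric_reflection v f" "f (e 0) \<noteq> 0"
    "norm (f (e 0)) * norm (coord 0 v) < 1" "norm (f (e 0)) * norm (coord 0 v) \<noteq> 1 / 2"
    using ex_reflection_generic_weight[OF T, of n] neg by blast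
  have small_reflections
    unfolding small_reflections_def
  proof (intro allI impI)
    fix \<delta> :: real assume "\<delta> > 0"
    with vf show "\<exists>w g k. isometric_reflection w g \<and> g (e 0) \<noteq> 0 \<and> k \<noteq> 0 \<and>
      coord k w \<noteq> 0 \<and> fnorm (smul (2 * g (e 0)) w) < \<delta>"
      using ex_small_reflection[OF vf, of \<delta>] by metis
  qed
  then show False using isomorphic_to_ell2 not_ell2 by blast
qed

text \<open>A series of multiples of the \<open>e k\<close> with positive coefficients so small that it converges.\<close>
lemma ex_all_coords_nonzero: "\<exists>x. \<forall>k. coord k x \<noteq> 0"
proof -
  have "\<exists>t. t > 0 \<and> \<phi> t < (1 / 2) ^ k" for k
    by (rule \<phi>_small[of "(1 / 2) ^ k"]) auto
  then obtain t where t: "\<And>k. t k > 0" "\<And>k. \<phi> (t k) < (1 / 2) ^ k" by metis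
  define S where "S N = (\<Sum>k<N. smul (of_real (t k)) (e k))" for N
  have step: "fnorm (S n - S m) \<le> 2 * (1 / 2) ^ m - 2 * (1 / 2) ^ n" if "m \<le> n" for m n
    using that
  proof (induction n rule: dec_induct)
    case (step n)
    have eq: "S (Suc n) - S m = (S n - S m) + smul (of_real (t n)) (e n)" by (simp add: S_def)
    have "fnorm (S (Suc n) - S m) \<le> fnorm (S n - S m) + \<phi> (t n)"
      unfolding eq \<phi>_def fnorm_smul_e[of _ n, symmetric] by (rule fnorm_triangle)
    with step t(2)[of n] show ?case by simp
  qed simp
  have "\<exists>x. fconv S x"
  proof (rule Cauchy_fconv)
    fix \<delta> :: real assume "\<delta> > 0"
    then obtain M where M: "(1 / 2) ^ M < \<delta> / 2"
      using real_arch_pow_inv[of "\<delta> / 2" "1 / 2"] by auto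
    have "fnorm (S n - S m) < \<delta>" if "m \<ge> M" "n \<ge> m" for m n
    proof -
      have "(1 / 2 :: real) ^ m \<le> (1 / 2) ^ M" using that(1) by (intro power_decreasing) auto
      moreover have "(0::real) < (1 / 2) ^ n" by simp
      ultimately show ?thesis using step[OF that(2)] M by linarith
    qed
    then show "\<exists>M. \<forall>m\<ge>M. \<forall>n\<ge>m. fnorm (S n - S m) < \<delta>" by blast
  qed
  then obtain x where "fconv (\<lambda>N. \<Sum>k<N. smul (of_real (t k)) (e k)) x" unfolding S_def by blast
  then have "coord k x = of_real (t k)" for k by (rule coord_unique)
  then have "coord k x \<noteq> 0" for k using t(1)[of k] by simp
  then show ?thesis by blast
qed

lemma Iso_continuous:
  assumes T: "T \<in> Iso smul fnorm"
  shows "T \<in> continuous_operators smul fnorm"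
proof -
  interpret X: Metric_space UNIV "fdist fnorm" by (rule Metric_space_fdist)
  have "continuous_map (ftopology fnorm) (ftopology fnorm) T"
    unfolding ftopology_def X.metric_continuous_map[OF Metric_space_fdist]
    using Iso_fnorm[OF T] by (auto simp: fdist_def simp flip: Iso_diff[OF T])
  with T show ?thesis by (simp add: continuous_operators_def Iso_def)
qed

lemma continuous_operator_fconv:
  assumes "T \<in> continuous_operators smul fnorm" "fconv X x"
  shows "fconv (\<lambda>i. T (X i)) (T x)"
proof -
  have "limitin (ftopology fnorm) (T \<circ> X) (T x) sequentially"
    using assms by (intro continuous_map_limit) (auto simp: continuous_operators_def limitin_ftopology_iff)
  then show ?thesis by (simp add: limitin_ftopology_iff comp_def)
qed

text \<open>An operator that locally agrees with isometries maps the basis to itself up to phases. The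
  vectors \<open>e n + e m\<close> show that the index map is injective; a vector without zero coordinates
  shows that it is surjective.\<close>
lemma local_isometry_Iso:
  assumes monomial: "\<And>L n. L \<in> Iso smul fnorm \<Longrightarrow> \<exists>a k. norm a = 1 \<and> L (e n) = smul a (e k)"
    and T: "T \<in> continuous_operators smul fnorm" and loc: "\<And>x. \<exists>L\<in>Iso smul fnorm. T x = L x"
  shows "T \<in> Iso smul fnorm"
proof -
  have "\<forall>n. \<exists>a k. norm a = 1 \<and> T (e n) = smul a (e k)"
    using loc monomial by metis
  then obtain \<epsilon> \<pi> where a: "\<And>n. norm (\<epsilon> n) = 1" and Te: "\<And>n. T (e n) = smul (\<epsilon> n) (e (\<pi> n))"
    by metis
  have \<epsilon>: "unimodular \<epsilon>" using a by (simp add: unimodular_def)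
  have Tadd: "T (x + y) = T x + T y" and Tsmul: "T (smul b x) = smul b (T x)" for b x y
    using T by (auto simp: continuous_operators_def Vector_Spaces.linear_iff)
  have T0: "T 0 = 0" using Tsmul[of 0 0] by simp
  have Tsum: "T (\<Sum>i\<in>A. g i) = (\<Sum>i\<in>A. T (g i))" for A :: "nat set" and g
    by (induction A rule: infinite_finite_induct) (simp_all add: T0 Tadd)
  have inj: "inj \<pi>"
  proof (rule injI, rule ccontr)
    fix n m assume eq: "\<pi> n = \<pi> m" and neq: "n \<noteq> m"
    obtain L where L: "L \<in> Iso smul fnorm" "T (e n + e m) = L (e n + e m)" using loc by blast
    obtain b c j k where bc: "norm b = 1" "norm c = 1" "L (e n) = smul b (e j)" "L (e m) = smul c (e k)"
      using monomial[OF L(1)] by metis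
    have nz: "b \<noteq> 0" "c \<noteq> 0" using bc by auto
    have jk: "j \<noteq> k"
    proof
      assume "j = k"
      then have "L (smul c (e n)) = L (smul b (e m))"
        by (simp add: Iso_smul[OF L(1)] bc mult.commute)
      then have "smul c (e n) = smul b (e m)"
        using Iso_bij[OF L(1)] by (simp add: bij_is_inj inj_eq)
      then have "coord n (smul c (e n)) = coord n (smul b (e m))" by simp
      then show False using neq nz by (simp add: coord_e)
    qed
    have "smul (\<epsilon> n + \<epsilon> m) (e (\<pi> n)) = smul b (e j) + smul c (e k)"
      using L(2) by (simp add: Tadd Te eq Iso_add[OF L(1)] bc scale_left_distrib)
    then have "coord i (smul (\<epsilon> n + \<epsilon> m) (e (\<pi> n))) = coord i (smul b (e j) + smul c (e k))" for i
      by simp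
    from this[of j] this[of k] show False using nz jk by (auto simp: coord_e split: if_splits)
  qed
  have lim: "fconv (\<lambda>N. \<Sum>k<N. smul (\<epsilon> k * coord k x) (e (\<pi> k))) (T x)" for x
    using continuous_operator_fconv[OF T coord_expansion[of x]]
    by (simp add: Tsum Tsmul Te mult.commute)
  have surj: "surj \<pi>"
  proof (rule ccontr)
    assume "\<not> surj \<pi>"
    then obtain m where m: "m \<notin> range \<pi>" by blast
    obtain x where x: "\<And>k. coord k x \<noteq> 0" using ex_all_coords_nonzero by blast
    have "coord m (\<Sum>k<N. smul (\<epsilon> k * coord k x) (e (\<pi> k))) = 0" for N
      using m by (auto simp: coord_e intro!: sum.neutral)
    then have Tx: "coord m (T x) = 0"
      using coord_fconv[OF lim[of x], of m] by (simp add: LIMSEQ_const_iff)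
    obtain L where L: "L \<in> Iso smul fnorm" "T x = L x" using loc by blast
    obtain a n where n: "norm a = 1" "inv L (e m) = smul a (e n)"
      using monomial[OF Iso_inv[OF L(1)]] by blast
    \<comment> \<open>the coordinate \<open>m\<close> of \<open>L x\<close> is a nonzero multiple of a single coordinate of \<open>x\<close>\<close>
    define r where "r y = coord m (L y)" for y
    have r: "isometric_reflection (inv L (e m)) r"
      using reflection_conj[OF Iso_inv[OF L(1)] coord_reflection[of m]]
      by (simp add: r_def[abs_def] inv_inv_eq[OF Iso_bij[OF L(1)]])
    have "r (e k) = 0" if "k \<noteq> n" for k
      using reflection_zero_iff[OF r, of k] that by (simp add: n coord_e)
    then have "(\<Sum>k<N. coord k x * r (e k)) = coord n x * r (e n)" if "N > n" for N
      using that by (subst sum.mono_neutral_right[of _ "{n}"]) auto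
    then have "(\<lambda>N. \<Sum>k<N. coord k x * r (e k)) \<longlonglongrightarrow> coord n x * r (e n)"
      by (intro tendsto_eventually eventually_sequentiallyI[of "Suc n"]) simp
    with reflection_expansion[OF r, of x] have "r x = coord n x * r (e n)"
      by (metis LIMSEQ_unique)
    moreover have "r (e n) \<noteq> 0"
      using reflection_zero_iff[OF r, of n] n by (auto simp: coord_e)
    ultimately show False using Tx x[of n] by (simp add: r_def L(2))
  qed
  have \<pi>: "bij \<pi>" using inj surj by (rule bijI)
  have "T x = monomial \<epsilon> \<pi> x" for x
    by (rule fconv_unique[OF lim monomial_expansion[OF \<epsilon> \<pi>]])
  then have "T = monomial \<epsilon> \<pi>" by (rule ext)
  then show ?thesis using monomial_Iso[OF \<epsilon> \<pi>] by simp
qed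

lemma algebraically_reflexive_Iso:
  assumes "\<not> isomorphic_to_ell2 smul fnorm"
  shows "algebraically_reflexive smul fnorm (Iso smul fnorm)"
  unfolding algebraically_reflexive_def
proof
  show "ref_al smul fnorm (Iso smul fnorm) \<subseteq> Iso smul fnorm"
  proof
    fix T assume T: "T \<in> ref_al smul fnorm (Iso smul fnorm)"
    show "T \<in> Iso smul fnorm"
    proof (rule local_isometry_Iso)
      show "\<exists>a k. norm a = 1 \<and> L (e n) = smul a (e k)" if "L \<in> Iso smul fnorm" for L n
        by (rule Iso_e[OF that assms])
    qed (use T in \<open>simp_all add: ref_al_def\<close>)
  qed
  show "Iso smul fnorm \<subseteq> ref_al smul fnorm (Iso smul fnorm)"
    using Iso_continuous by (auto simp: ref_al_def)
qed

end

theorem theorem1: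
  shows
    "(\<forall>(smul :: real \<Rightarrow> 'a::ab_group_add \<Rightarrow> 'a) fnorm.
        F_space smul fnorm \<and> \<not> isomorphic_to_ell2 smul fnorm \<and>
        (\<exists>e. symmetric_basis smul fnorm e) \<longrightarrow>
        algebraically_reflexive smul fnorm (Iso smul fnorm)) \<and>
     (\<forall>(smul :: complex \<Rightarrow> 'b::ab_group_add \<Rightarrow> 'b) fnorm.
        F_space smul fnorm \<and> \<not> isomorphic_to_ell2 smul fnorm \<and>
        (\<exists>e. symmetric_basis smul fnorm e) \<longrightarrow>
        algebraically_reflexive smul fnorm (Iso smul fnorm))"
proof (intro conjI allI impI; elim conjE exE)
  fix smul :: "real \<Rightarrow> 'a \<Rightarrow> 'a" and fnorm e
  assume F: "F_space smul fnorm" "symmetric_basis smul fnorm e" and n: "\<not> isomorphic_to_ell2 smul fnorm"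
  interpret symmetric_basis_space smul fnorm e
    by (intro symmetric_basis_space.intro F symmetric_basis_space_axioms.intro chebyshev_field_real)
  show "algebraically_reflexive smul fnorm (Iso smul fnorm)" by (rule algebraically_reflexive_Iso[OF n])
next
  fix smul :: "complex \<Rightarrow> 'b \<Rightarrow> 'b" and fnorm e
  assume F: "F_space smul fnorm" "symmetric_basis smul fnorm e" and n: "\<not> isomorphic_to_ell2 smul fnorm"
  interpret symmetric_basis_space smul fnorm e
    by (intro symmetric_basis_space.intro F symmetric_basis_space_axioms.intro chebyshev_field_complex)
  show "algebraically_reflexive smul fnorm (Iso smul fnorm)" by (rule algebraically_reflexive_Iso[OF n])
qed

end
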